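(* Let $\{x(t)\}_{t\ge 1}$ be the iterates of the stochastic mirror descent algorithm $$x(t+1)=\operatorname*{arg\,min}_{x\in\mathbb{X}}\Big\{\langle \tilde g(t),x-x(t)\rangle+\frac{1}{\alpha(t)}\mathbb{D}_R(x,x(t))\Big\},\qquad t\ge 1,$$ for the problem $\min_{x\in\mathbb{X}}f(x)$, under Assumptions A1, A2, A3 and the Sub-Gaussian Assumption A4 of the context, and let $z(t)=\big(\sum_{k=1}^t\alpha(k)\big)^{-1}\sum_{j=1}^t\alpha(j)x(j)$. Then for every $\epsilon>0$ there exists $t_0\in\mathbb{N}$ such that for all $t\ge t_0$ $$\mathbb{P}\big(f(z(t))-f^\ast\ge\epsilon\big)\le\exp\left(\frac{-\epsilon^2\mathrm{K}^2\big(\sum_{k=1}^t\alpha(k)\big)^2}{18D^2\nu_1^2\sum_{k=1}^t\alpha(k)^2}\right)+\frac{\exp\Big(\sum_{k=1}^t\frac{\alpha(k)^2}{2\sigma_R}\kappa_1\Big(G^2+B(k)^2+\frac{\nu_2^2\alpha(k)^2\kappa_1}{4\sigma_R}\Big)\Big)}{\exp\Big(\frac{\epsilon}{3}\mathrm{K}\sum_{k=1}^t\alpha(k)\Big)},$$ where $\mathrm{K}=\exp\big(-\sum_{k=1}^\infty \frac{2\alpha(k)B(k)}{\sigma_R}\big)$.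
   Context: Setting. $\|\cdot\|$ is an arbitrary norm on $\mathbb{R}^n$, $\|x\|_\ast=\sup\{\langle x,y\rangle:\|y\|\le 1\}$ its dual norm. $\mathbb{X}\subseteq\mathbb{R}^n$ is nonempty, convex and compact with diameter $D=\sup_{x,y\in\mathbb{X}}\|x-y\|$. $f:\mathbb{R}^n\to\mathbb{R}$ is convex (and continuous), $f^\ast=\min_{x\in\mathbb{X}}f(x)$. $G>0$ is a constant with $\|g\|_\ast\le G$ for all $g\in\partial f(x)$ and all $x\in\mathbb{X}$. Bregman divergence. $R$ is $\sigma_R$-strongly convex with respect to $\|\cdot\|$ ($\sigma_R>0$) and differentiable on an open set containing $\mathbb{X}$, and $\mathbb{D}_R(x,y)=R(x)-R(y)-\langle\nabla R(y),x-y\rangle$ for $x,y\in\mathbb{X}$. Algorithm. $x(1)\in\mathbb{X}$ is the initial point, $\alpha(t)>0$ are deterministic step-sizes, and $\tilde g(t)$ is a random vector (a noisy subgradient of $f$ at $x(t)$). $\mathcal{F}_t=\sigma(x(1),\dots,x(t))$. Assumption A1. $\mathbb{E}[\tilde g(t)\mid\mathcal{F}_t]=g(t)+b(t)$ a.s., where $g(t)\in\partial f(x(t))$ is a subgradient of $f$ at $x(t)$ and $b(t)$ is an $\mathcal{F}_t$-measurable random vector (the bias); and $\mathbb{E}[\|\tilde g(t)\|_\ast^2\mid\mathcal{F}_t]\le\nu^2$ a.s. for all $t$, for a constant $\nu$. Put $\zeta(t)=\tilde g(t)-g(t)-b(t)$, so $\mathbb{E}[\zeta(t)\mid\mathcal{F}_t]=0$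 a.s. Assumption A2. $\sum_{t\ge1}\alpha(t)=\infty$ and $\sum_{t\ge1}\alpha(t)^2<\infty$. Assumption A3. $B(t)\ge 0$ are deterministic numbers with $\|b(t)\|_\ast\le B(t)$ a.s. for all $t$, and $\sum_{t\ge1}\alpha(t)B(t)<\infty$. Assumption A4 (Sub-Gaussian noise). There is $\nu_1>0$ such that for all $t$, all $x\in\mathbb{R}^n$ and all $\lambda\in\mathbb{R}$, $\mathbb{E}[\exp(\lambda\langle x,\zeta(t)\rangle)\mid\mathcal{F}_t]\le\exp\big(\tfrac12\|x\|^2\nu_1^2\lambda^2\big)$ a.s. Constants. $\kappa_1>0$ is a constant such that $\|u+v+w\|_\ast^2\le\kappa_1(\|u\|_\ast^2+\|v\|_\ast^2+\|w\|_\ast^2)$ for all $u,v,w\in\mathbb{R}^n$. $\nu_2>0$ is a (deterministic) constant such that $\mathbb{E}[\|\zeta(t)\|_\ast^4\mid\mathcal{F}_t]\le\nu_2^2$ a.s. for all $t$. *)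

theory Defs
  imports "HOL-Probability.Probability"
begin

definition is_norm :: "('a::real_vector \<Rightarrow> real) \<Rightarrow> bool" where
  "is_norm N \<longleftrightarrow>
    (\<forall>x. 0 \<le> N x) \<and> (\<forall>x. N x = 0 \<longleftrightarrow> x = 0) \<and>
    (\<forall>c x. N (c *\<^sub>R x) = \<bar>c\<bar> * N x) \<and> (\<forall>x y. N (x + y) \<le> N x + N y)"

definition dual_norm :: "('a::real_inner \<Rightarrow> real) \<Rightarrow> 'a \<Rightarrow> real" where
  "dual_norm N x = (SUP y\<in>{y. N y \<le> 1}. x \<bullet> y)"

definition diam :: "('a::real_vector \<Rightarrow> real) \<Rightarrow> 'a set \<Rightarrow> real" where
  "diam N S = (SUP (x, y)\<in>S \<times> S. N (x - y))"

definition subdifferential :: "('a::real_inner \<Rightarrow> real) \<Rightarrow> 'a \<Rightarrow> 'a set" where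
  "subdifferential f x = {g. \<forall>y. f y \<ge> f x + g \<bullet> (y - x)}"

definition strongly_convex_on ::
  "'a::real_vector set \<Rightarrow> ('a \<Rightarrow> real) \<Rightarrow> real \<Rightarrow> ('a \<Rightarrow> real) \<Rightarrow> bool" where
  "strongly_convex_on S N \<sigma> R \<longleftrightarrow> convex S \<and>
    (\<forall>x\<in>S. \<forall>y\<in>S. \<forall>u\<ge>0. \<forall>v\<ge>0. u + v = 1 \<longrightarrow>
      R (u *\<^sub>R x + v *\<^sub>R y) \<le> u * R x + v * R y - \<sigma> / 2 * u * v * (N (x - y))\<^sup>2)"

text \<open>The gradient is taken with respect to the Euclidean inner product and is
  meaningful only at points of differentiability.\<close>

definition gradient :: "('a::real_inner \<Rightarrow> real) \<Rightarrow> 'a \<Rightarrow> 'a" where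
  "gradient R y = (THE d. GDERIV R y :> d)"

definition bregman :: "('a::real_inner \<Rightarrow> real) \<Rightarrow> 'a \<Rightarrow> 'a \<Rightarrow> real" where
  "bregman R x y = R x - R y - gradient R y \<bullet> (x - y)"

text \<open>The sigma-algebra generated by \<open>x 1, \<dots>, x t\<close>. Only its measurable sets matter;
  the measure carried by the \<open>sigma\<close> construction is irrelevant to conditional expectations.\<close>

definition history :: "'w measure \<Rightarrow> (nat \<Rightarrow> 'w \<Rightarrow> 'a::topological_space) \<Rightarrow> nat \<Rightarrow> 'w measure" where
  "history M x t = sigma (space M) (\<Union>s\<in>{1..t}. {x s -` A \<inter> space M | A. A \<in> sets borel})"

definition vec_cond_exp ::
  "'w measure \<Rightarrow> 'w measure \<Rightarrow> ('w \<Rightarrow> real ^ 'n) \<Rightarrow> 'w \<Rightarrow> real ^ 'n" where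
  "vec_cond_exp M F X = (\<lambda>\<omega>. \<chi> i. real_cond_exp M F (\<lambda>\<omega>'. X \<omega>' $ i) \<omega>)"

definition weighted_avg :: "(nat \<Rightarrow> real) \<Rightarrow> (nat \<Rightarrow> 'a::real_vector) \<Rightarrow> nat \<Rightarrow> 'a" where
  "weighted_avg \<alpha> x t = inverse (\<Sum>k=1..t. \<alpha> k) *\<^sub>R (\<Sum>j=1..t. \<alpha> j *\<^sub>R x j)"

end

theory Submission
  imports Defs
begin

text \<open>
  Fix a minimiser \<open>p\<close> of \<open>f\<close> on \<open>X\<close> and write \<open>A t\<close> for the sum of the first \<open>t\<close> step sizes. The
  second summand of the claimed bound is at least \<open>exp (- \<epsilon> / 3 * K * A t)\<close>, and \<open>K \<le> 1\<close>. So it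
  suffices to prove \<open>P (f (z t) - f p \<ge> \<epsilon>) \<le> C * exp (- \<epsilon> * A t)\<close> for some constant \<open>C\<close>: as
  \<open>A t\<close> tends to infinity, the surplus \<open>exp (- 2 * \<epsilon> / 3 * A t)\<close> eventually absorbs \<open>C\<close>. By
  Jensen and Markov this follows once the expectation of
  \<open>exp (\<Sum>k=1..t. \<alpha> k * (f (x k) - f p))\<close> is bounded uniformly in \<open>t\<close>
  (\<open>mirror_descent_exponential_moment\<close>).

  The noise \<open>\<zeta> t\<close> is in general not a function of \<open>x 1, \<dots>, x (t + 1)\<close>, because the projection onto
  \<open>X\<close> hides part of it. Sums of noise terms are therefore not martingales for the filtration at
  hand. The potential
    \<open>\<Phi> k = exp (bregman R p (x k) + (\<Sum>j=1..<k. \<alpha> j * (f (x j) - f p)))\<close>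
  involves the iterates only and thus is adapted; it dominates the exponential above since
  Bregman divergences are nonnegative. The basic inequality of mirror descent
  (\<open>mirror_step_inequality\<close>) bounds \<open>\<Phi> (k + 1) / \<Phi> k\<close> by the exponential of a bias term of order
  \<open>\<alpha> k * B k\<close>, a centred term linear in \<open>\<zeta> k\<close>, and an excess that is quadratic in
  \<open>\<alpha> k * norm (g k + \<zeta> k)\<close> but, \<open>X\<close> being bounded, also grows at most linearly in it.
  The linear growth makes ordinary exponential moments of the noise sufficient
  (\<open>exp_step_bound\<close>): the inequality \<open>exp u \<le> 1 + u + u\<^sup>2 * exp \<bar>u\<bar>\<close> separates the centred linear term,
  which integrates to zero, from a remainder of size \<open>(\<alpha> k)\<^sup>2 * exp (s * norm (\<zeta> k))\<close> with a fixed
  \<open>s\<close>, whose conditional expectation the sub-Gaussian assumption controls along the coordinate axes.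
  Hence the expectation of \<open>\<Phi>\<close> grows in step \<open>k\<close> by a factor of at most the exponential of a
  constant times \<open>\<alpha> k * B k + (\<alpha> k)\<^sup>2\<close>, and this is summable.
\<close>

section \<open>Norms and dual norms on Euclidean space\<close>

lemma is_norm_uminus: "is_norm N \<Longrightarrow> N (- v) = N v"
  unfolding is_norm_def by (metis abs_minus_cancel abs_one mult_1 scaleR_minus1_left)

lemma is_norm_le_norm:
  fixes N :: "real ^ 'n \<Rightarrow> real"
  assumes "is_norm N"
  obtains L where "L > 0" "\<And>v. N v \<le> L * norm v"
proof -
  have tri: "N (u + v) \<le> N u + N v" and sc: "N (c *\<^sub>R v) = \<bar>c\<bar> * N v"
    and nn: "0 \<le> N v" and z: "N 0 = 0" for u v c
    using assms unfolding is_norm_def by auto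
  have sum_le: "N (sum h S) \<le> (\<Sum>i\<in>S. N (h i))" if "finite S" for h :: "'n \<Rightarrow> real ^ 'n" and S
    using that
  proof (induction S rule: finite_induct)
    case (insert i S)
    then show ?case using tri[of "h i" "sum h S"] by simp
  qed (simp add: z)
  define L where "L = (\<Sum>i\<in>UNIV. N (axis i 1)) + 1"
  show ?thesis
  proof
    show "L > 0" unfolding L_def using sum_nonneg[of UNIV "\<lambda>i. N (axis i 1)"] nn by force
    fix v :: "real ^ 'n"
    have "v = (\<Sum>i\<in>UNIV. (v $ i) *\<^sub>R axis i 1)"
      using basis_expansion[of v] by (simp add: scalar_mult_eq_scaleR)
    then have "N v \<le> (\<Sum>i\<in>UNIV. N ((v $ i) *\<^sub>R axis i 1))"
      using sum_le[of UNIV] by (metis finite_class.finite_UNIV)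
    also have "\<dots> \<le> (\<Sum>i\<in>UNIV. norm v * N (axis i 1))"
      unfolding sc by (intro sum_mono mult_right_mono nn component_le_norm_cart)
    also have "\<dots> \<le> L * norm v"
      unfolding L_def by (simp add: sum_distrib_left algebra_simps)
    finally show "N v \<le> L * norm v" .
  qed
qed

text \<open>A norm attains a positive minimum on the Euclidean unit sphere, being continuous there by
  the reverse triangle inequality.\<close>

lemma norm_le_is_norm:
  fixes N :: "real ^ 'n \<Rightarrow> real"
  assumes "is_norm N"
  obtains m where "m > 0" "\<And>v. m * norm v \<le> N v"
proof -
  have tri: "N (u + v) \<le> N u + N v" and sc: "N (c *\<^sub>R v) = \<bar>c\<bar> * N v"
    and nn: "0 \<le> N v" and z: "N v = 0 \<longleftrightarrow> v = 0" for u v c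
    using assms unfolding is_norm_def by auto
  obtain L where L: "L > 0" "\<And>v. N v \<le> L * norm v" using is_norm_le_norm[OF assms] by blast
  have lip: "\<bar>N u - N v\<bar> \<le> L * norm (u - v)" for u v
    using tri[of v "u - v"] tri[of u "v - u"] L(2)[of "u - v"] is_norm_uminus[OF assms, of "u - v"]
    by simp
  have "continuous_on UNIV N"
    by (rule lipschitz_on_continuous_on[of L])
      (use L lip in \<open>auto simp: lipschitz_on_def dist_norm\<close>)
  then have cont: "continuous_on (sphere 0 1) N" by (rule continuous_on_subset) simp
  have ne: "sphere 0 1 \<noteq> ({} :: (real ^ 'n) set)" by simp
  obtain w where w: "w \<in> sphere 0 1" "\<And>v. v \<in> sphere 0 1 \<Longrightarrow> N w \<le> N v"
    using continuous_attains_inf[OF compact_sphere ne cont] by blast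
  show ?thesis
  proof
    show "N w > 0" using w(1) z[of w] nn[of w] by (auto simp: less_le)
    fix v :: "real ^ 'n"
    show "N w * norm v \<le> N v"
    proof (cases "v = 0")
      case False
      have "N w \<le> N (inverse (norm v) *\<^sub>R v)" using False by (intro w(2)) simp
      then show ?thesis using False by (simp add: sc field_simps)
    qed (simp add: nn)
  qed
qed

text \<open>Test the supremum defining the dual norm on the vector \<open>g / N g\<close>. The lower equivalence
  constant of \<open>N\<close> enters only to see that the supremum is over a bounded set.\<close>

lemma norm_le_dual_norm:
  fixes N :: "real ^ 'n \<Rightarrow> real"
  assumes "is_norm N" and L: "\<And>v. N v \<le> L * norm v"
  shows "norm g \<le> L * dual_norm N g"
proof (cases "g = 0")
  case True
  have N0: "N 0 = 0" using assms(1) unfolding is_norm_def by auto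
  have "(\<lambda>y. (0 :: real ^ 'n) \<bullet> y) ` {y. N y \<le> 1} = {0}"
    using N0 by (auto intro!: image_eqI[of _ _ 0])
  then show ?thesis unfolding True dual_norm_def by simp
next
  case False
  have sc: "N (c *\<^sub>R v) = \<bar>c\<bar> * N v" and nn: "0 \<le> N v" and z: "N v = 0 \<longleftrightarrow> v = 0" for v c
    using assms(1) unfolding is_norm_def by auto
  have pos: "N g > 0" using z[of g] nn[of g] False by (auto simp: less_le)
  have Lpos: "L > 0"
    using pos L[of g] False by (metis less_le_trans norm_ge_zero zero_less_mult_pos2 zero_less_norm_iff)
  obtain m where m: "m > 0" "\<And>v. m * norm v \<le> N v" using norm_le_is_norm[OF assms(1)] by blast
  have bdd: "bdd_above ((\<lambda>y. g \<bullet> y) ` {y. N y \<le> 1})"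
  proof (rule bdd_aboveI2)
    fix y assume "y \<in> {y. N y \<le> 1}"
    then have "m * norm y \<le> 1" using m(2)[of y] by simp
    then have "norm y \<le> 1 / m" using m(1) by (simp add: field_simps)
    then show "g \<bullet> y \<le> norm g * (1 / m)"
      by (meson norm_cauchy_schwarz mult_left_mono norm_ge_zero order_trans)
  qed
  have "g \<bullet> (inverse (N g) *\<^sub>R g) \<le> dual_norm N g"
    unfolding dual_norm_def by (rule cSUP_upper[OF _ bdd]) (use pos in \<open>simp add: sc\<close>)
  then have "(norm g)\<^sup>2 \<le> N g * dual_norm N g"
    using pos by (simp add: power2_norm_eq_inner field_simps)
  moreover have "0 \<le> dual_norm N g"
    using \<open>g \<bullet> (inverse (N g) *\<^sub>R g) \<le> dual_norm N g\<close> pos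
    by (smt (verit) inner_ge_zero inner_scaleR_right inverse_nonnegative_iff_nonnegative mult_nonneg_nonneg)
  ultimately have "(norm g)\<^sup>2 \<le> (L * norm g) * dual_norm N g"
    by (meson L mult_right_mono order_trans)
  then show ?thesis using False by (simp add: power2_eq_square)
qed

section \<open>Bregman divergences and the mirror step\<close>

lemma gradient_has_derivative:
  fixes R :: "'a::euclidean_space \<Rightarrow> real"
  assumes "R differentiable (at y)"
  shows "(R has_derivative (\<lambda>h. gradient R y \<bullet> h)) (at y)"
proof -
  obtain T where T: "(R has_derivative T) (at y)" using assms unfolding differentiable_def by blast
  interpret T: linear T using T by (rule has_derivative_linear)
  define d where "d = (\<Sum>b\<in>Basis. T b *\<^sub>R b)"
  have Td: "T = (\<lambda>h. h \<bullet> d)"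
  proof
    fix h
    have "T h = T (\<Sum>b\<in>Basis. (h \<bullet> b) *\<^sub>R b)" by (simp add: euclidean_representation)
    also have "\<dots> = h \<bullet> d"
      unfolding d_def T.sum T.scale inner_sum_right by (simp add: mult.commute)
    finally show "T h = h \<bullet> d" .
  qed
  have d: "GDERIV R y :> d" 
    unfolding gderiv_def using T unfolding Td .
  have "d' = d" if "GDERIV R y :> d'" for d'
  proof -
    have "(\<lambda>h. h \<bullet> d') = (\<lambda>h. h \<bullet> d)"
      using that d unfolding gderiv_def by (rule has_derivative_unique)
    then show ?thesis by (metis inner_commute vector_eq_ldot)
  qed
  then have "gradient R y = d" unfolding gradient_def using d by (rule the_equality[rotated])
  then show ?thesis using d unfolding gderiv_def by (simp add: inner_commute)
qed

lemma difference_quotient_tendsto_gradient: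
  fixes R :: "'a::euclidean_space \<Rightarrow> real"
  assumes "R differentiable (at y)"
  shows "(\<lambda>n. real (Suc n) * (R (y + inverse (real (Suc n)) *\<^sub>R h) - R y))
    \<longlonglongrightarrow> gradient R y \<bullet> h"
proof -
  have "((\<lambda>s. R (y + s *\<^sub>R h)) has_derivative (\<lambda>s. gradient R y \<bullet> (s *\<^sub>R h))) (at 0)"
    by (rule has_derivative_compose[of "\<lambda>s. y + s *\<^sub>R h" "\<lambda>s. s *\<^sub>R h" 0 UNIV R])
      (use gradient_has_derivative[OF assms] in \<open>auto intro!: derivative_eq_intros\<close>)
  then have "((\<lambda>s. R (y + s *\<^sub>R h)) has_field_derivative (gradient R y \<bullet> h)) (at 0)"
    by (rule has_derivative_imp_has_field_derivative) simp
  then have lim: "((\<lambda>s. (R (y + s *\<^sub>R h) - R y) / s) \<longlongrightarrow> gradient R y \<bullet> h) (at 0)"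
    unfolding DERIV_def by simp
  have "filterlim (\<lambda>n. inverse (real (Suc n))) (at 0) sequentially"
    unfolding filterlim_at using LIMSEQ_inverse_real_of_nat by auto
  from filterlim_compose[OF lim this] show ?thesis by (simp add: field_simps)
qed

text \<open>The supporting hyperplane inequality with its quadratic gain: divide the defining inequality
  of strong convexity on the segment from \<open>y\<close> to \<open>u\<close> by the weight of \<open>u\<close> and let
  the weight tend to \<open>0\<close>.\<close>

lemma strongly_convex_bregman_ge:
  fixes R :: "'a::euclidean_space \<Rightarrow> real"
  assumes sc: "strongly_convex_on U N \<sigma> R" and "R differentiable (at y)" "u \<in> U" "y \<in> U"
  shows "\<sigma> / 2 * (N (u - y))\<^sup>2 \<le> bregman R u y"
proof -
  define c where "c = \<sigma> / 2 * (N (u - y))\<^sup>2"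
  have "real (Suc n) * (R (y + inverse (real (Suc n)) *\<^sub>R (u - y)) - R y)
     \<le> R u - R y - (1 - inverse (real (Suc n))) * c" for n
  proof -
    define s where "s = inverse (real (Suc n))"
    have s: "0 < s" "s \<le> 1" "real (Suc n) * s = 1" unfolding s_def by (auto simp: field_simps)
    have "R (s *\<^sub>R u + (1 - s) *\<^sub>R y) \<le> s * R u + (1 - s) * R y - \<sigma> / 2 * s * (1 - s) * (N (u - y))\<^sup>2"
      using sc assms(3,4) s unfolding strongly_convex_on_def by auto
    moreover have "s *\<^sub>R u + (1 - s) *\<^sub>R y = y + s *\<^sub>R (u - y)" by (simp add: algebra_simps)
    ultimately have "R (y + s *\<^sub>R (u - y)) - R y \<le> s * (R u - R y - (1 - s) * c)"
      unfolding c_def by (simp add: algebra_simps)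
    then have "real (Suc n) * (R (y + s *\<^sub>R (u - y)) - R y) \<le> real (Suc n) * (s * (R u - R y - (1 - s) * c))"
      by (intro mult_left_mono) auto
    also have "\<dots> = R u - R y - (1 - s) * c" using s(3) by (simp add: mult.assoc[symmetric])
    finally show ?thesis unfolding s_def .
  qed
  moreover have "(\<lambda>n. R u - R y - (1 - inverse (real (Suc n))) * c) \<longlonglongrightarrow> R u - R y - (1 - 0) * c"
    by (intro tendsto_intros LIMSEQ_inverse_real_of_nat)
  ultimately have "gradient R y \<bullet> (u - y) \<le> R u - R y - (1 - 0) * c"
    using LIMSEQ_le[OF difference_quotient_tendsto_gradient[OF assms(2)]] by blast
  then show ?thesis unfolding bregman_def c_def by simp
qed

lemma bregman_three_point:
  "(gradient R z - gradient R y) \<bullet> (p - z) = bregman R p y - bregman R p z - bregman R z y"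
  unfolding bregman_def by (simp add: inner_diff_left inner_diff_right)

text \<open>The mirror step is a minimiser over a convex set, so the derivative of its objective in any
  feasible direction is nonnegative. With the three-point identity this is the basic inequality of
  mirror descent.\<close>

lemma mirror_step_inequality:
  fixes R :: "'a::euclidean_space \<Rightarrow> real"
  assumes min: "is_arg_min (\<lambda>u. h \<bullet> (u - y) + 1 / a * bregman R u y) (\<lambda>u. u \<in> X) z"
    and "convex X" "a > 0" "p \<in> X" and diff: "R differentiable (at z)"
  shows "a * (h \<bullet> (z - p)) \<le> bregman R p y - bregman R p z - bregman R z y"
proof -
  have z: "z \<in> X" using min unfolding is_arg_min_linorder by blast
  have ineq: "0 \<le> a * (h \<bullet> (p - z))
      + real (Suc n) * (R (z + inverse (real (Suc n)) *\<^sub>R (p - z)) - R z) - gradient R y \<bullet> (p - z)" for n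
  proof -
    define s where "s = inverse (real (Suc n))"
    have s: "0 < s" "s \<le> 1" "real (Suc n) * s = 1" unfolding s_def by (auto simp: field_simps)
    define q where "q = z + s *\<^sub>R (p - z)"
    have "q = (1 - s) *\<^sub>R z + s *\<^sub>R p" unfolding q_def by (simp add: algebra_simps)
    then have "q \<in> X" using convexD[OF \<open>convex X\<close> z \<open>p \<in> X\<close>, of "1 - s" s] s by simp
    then have "h \<bullet> (z - y) + 1 / a * bregman R z y \<le> h \<bullet> (q - y) + 1 / a * bregman R q y"
      using min unfolding is_arg_min_linorder by blast
    then have "a * (h \<bullet> (z - y) + 1 / a * bregman R z y) \<le> a * (h \<bullet> (q - y) + 1 / a * bregman R q y)"
      using \<open>a > 0\<close> by (intro mult_left_mono) auto
    then have "0 \<le> a * (h \<bullet> (q - z)) + R q - R z - gradient R y \<bullet> (q - z)"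
      using \<open>a > 0\<close> unfolding bregman_def by (simp add: algebra_simps)
    also have "\<dots> = s * (a * (h \<bullet> (p - z)) - gradient R y \<bullet> (p - z)) + (R q - R z)"
      unfolding q_def by (simp add: algebra_simps)
    finally have "0 \<le> real (Suc n) * (s * (a * (h \<bullet> (p - z)) - gradient R y \<bullet> (p - z)) + (R q - R z))"
      by simp
    also have "\<dots> = a * (h \<bullet> (p - z)) - gradient R y \<bullet> (p - z) + real (Suc n) * (R q - R z)"
      using s(3) unfolding distrib_left mult.assoc[symmetric] by simp
    finally show ?thesis unfolding q_def s_def by simp
  qed
  have "0 \<le> a * (h \<bullet> (p - z)) + gradient R z \<bullet> (p - z) - gradient R y \<bullet> (p - z)"
    by (rule LIMSEQ_le_const[of "\<lambda>n. a * (h \<bullet> (p - z))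
      + real (Suc n) * (R (z + inverse (real (Suc n)) *\<^sub>R (p - z)) - R z) - gradient R y \<bullet> (p - z)"])
      (use ineq difference_quotient_tendsto_gradient[OF diff] in \<open>auto intro!: tendsto_intros\<close>)
  then show ?thesis
    using bregman_three_point[of R z y p] by (simp add: algebra_simps)
qed

text \<open>Only the gradient term needs an upper bound. Prolong the segment from \<open>p\<close> to \<open>y\<close> beyond \<open>y\<close> by
  a fixed proportion \<open>s\<close>, chosen by compactness so small that the end point \<open>h y\<close> stays in \<open>U\<close>;
  convexity then bounds the slope at \<open>y\<close> by a difference of values of \<open>R\<close> on compact sets.\<close>

lemma bregman_bounded:
  fixes R :: "'a::euclidean_space \<Rightarrow> real"
  assumes sc: "strongly_convex_on U N \<sigma> R" and \<sigma>: "\<sigma> \<ge> 0"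
    and U: "open U" "X \<subseteq> U" "compact X" and diff: "R differentiable_on U" and p: "p \<in> X"
  obtains C where "\<And>y. y \<in> X \<Longrightarrow> bregman R p y \<le> C"
proof -
  obtain e where e: "e > 0" "(\<Union>y\<in>X. ball y e) \<subseteq> U"
    by (rule compact_subset_open_imp_ball_epsilon_subset[OF U(3,1,2)])
  obtain d where d: "d > 0" "\<And>y. y \<in> X \<Longrightarrow> norm (y - p) \<le> d"
  proof -
    obtain c where "\<And>y. y \<in> X \<Longrightarrow> norm y \<le> c"
      using compact_imp_bounded[OF U(3)] unfolding bounded_iff by auto
    then have "norm (y - p) \<le> c + norm p" if "y \<in> X" for y
      using that norm_triangle_ineq4[of y p] by fastforce
    then show ?thesis using that[of "max 1 (c + norm p)"] by fastforce
  qed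
  define s where "s = e / (2 * d)"
  have s: "s > 0" unfolding s_def using e d by simp
  define h where "h y = y + s *\<^sub>R (y - p)" for y
  have hU: "h y \<in> U" if "y \<in> X" for y
  proof -
    have "norm (s *\<^sub>R (y - p)) \<le> s * d" using d(2)[OF that] s by simp
    also have "\<dots> < e" unfolding s_def using e d by simp
    finally have "h y \<in> ball y e" unfolding h_def by (simp add: dist_norm)
    then show ?thesis using e(2) that by blast
  qed
  have contR: "continuous_on U R" using diff by (rule differentiable_imp_continuous_on)
  have "compact (h ` X)"
    unfolding h_def by (intro compact_continuous_image U continuous_intros)
  then have "compact (R ` h ` X)"
    by (rule compact_continuous_image[OF continuous_on_subset[OF contR], rotated]) (use hU in auto)
  moreover have "compact (R ` X)" by (rule compact_continuous_image[OF continuous_on_subset[OF contR U(2)] U(3)])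
  ultimately obtain A A' where "\<forall>r\<in>R ` h ` X. \<bar>r\<bar> \<le> A" "\<forall>r\<in>R ` X. \<bar>r\<bar> \<le> A'"
    using compact_imp_bounded[of "R ` h ` X"] compact_imp_bounded[of "R ` X"]
    unfolding bounded_iff real_norm_def by auto
  then have A: "\<bar>R (h y)\<bar> \<le> A" "\<bar>R y\<bar> \<le> A'" if "y \<in> X" for y using that by auto
  have "bregman R p y \<le> \<bar>R p\<bar> + A' + (A + A') / s" if y: "y \<in> X" for y
  proof -
    have "R differentiable (at y)"
      using diff y U(1,2) by (metis differentiable_on_eq_differentiable_at subsetD)
    then have "\<sigma> / 2 * (N (h y - y))\<^sup>2 \<le> bregman R (h y) y"
      using strongly_convex_bregman_ge[OF sc _ hU[OF y]] y U(2) by blast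
    moreover have "0 \<le> \<sigma> / 2 * (N (h y - y))\<^sup>2" using \<sigma> by simp
    ultimately have "0 \<le> bregman R (h y) y" by linarith
    then have "s * (gradient R y \<bullet> (y - p)) \<le> R (h y) - R y"
      unfolding bregman_def h_def by simp
    also have "\<dots> \<le> A + A'" using A[OF y] by linarith
    finally have "gradient R y \<bullet> (y - p) \<le> (A + A') / s" using s by (simp add: field_simps)
    moreover have "gradient R y \<bullet> (p - y) = - (gradient R y \<bullet> (y - p))" by (simp add: algebra_simps)
    ultimately show ?thesis unfolding bregman_def using A(2)[OF y] by linarith
  qed
  then show ?thesis using that by blast
qed

lemma measurable_continuous_compose_in:
  fixes Y :: "'w \<Rightarrow> 'a::euclidean_space" and h :: "'a \<Rightarrow> real"
  assumes "Y \<in> borel_measurable F" "\<And>\<omega>. \<omega> \<in> space F \<Longrightarrow> Y \<omega> \<in> X" "closed X" "continuous_on X h"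
  shows "(\<lambda>\<omega>. h (Y \<omega>)) \<in> borel_measurable F"
proof -
  have "(\<lambda>y. indicator X y *\<^sub>R h y) \<in> borel_measurable borel"
    by (rule borel_measurable_continuous_on_indicator[OF borel_closed[OF assms(3)] assms(4)])
  from measurable_compose[OF assms(1) this]
  have "(\<lambda>\<omega>. indicator X (Y \<omega>) *\<^sub>R h (Y \<omega>)) \<in> borel_measurable F" .
  also have "?this \<longleftrightarrow> ?thesis" by (intro measurable_cong) (use assms(2) in simp)
  finally show ?thesis .
qed

text \<open>The gradient term is a pointwise limit of difference quotients of \<open>R\<close> along the segment from
  \<open>Y \<omega>\<close> to \<open>p\<close>. This segment lies in \<open>X\<close>, so every quotient is a continuous function on \<open>X\<close>.\<close>

lemma measurable_bregman:
  fixes Y :: "'w \<Rightarrow> 'a::euclidean_space"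
  assumes Y: "Y \<in> borel_measurable F" "\<And>\<omega>. \<omega> \<in> space F \<Longrightarrow> Y \<omega> \<in> X"
    and X: "closed X" "convex X" "X \<subseteq> U" "open U" and diff: "R differentiable_on U" and p: "p \<in> X"
  shows "(\<lambda>\<omega>. bregman R p (Y \<omega>)) \<in> borel_measurable F"
proof (rule borel_measurable_LIMSEQ_real[where u = "\<lambda>n \<omega>. R p - R (Y \<omega>) - real (Suc n) *
      (R (Y \<omega> + inverse (real (Suc n)) *\<^sub>R (p - Y \<omega>)) - R (Y \<omega>))"])
  have contR: "continuous_on X R"
    by (rule continuous_on_subset[OF differentiable_imp_continuous_on[OF diff] X(3)])
  show "(\<lambda>\<omega>. R p - R (Y \<omega>) - real (Suc n) *
      (R (Y \<omega> + inverse (real (Suc n)) *\<^sub>R (p - Y \<omega>)) - R (Y \<omega>))) \<in> borel_measurable F" for n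
  proof (rule measurable_continuous_compose_in[OF Y X(1), where h = "\<lambda>y. R p - R y - real (Suc n) *
      (R (y + inverse (real (Suc n)) *\<^sub>R (p - y)) - R y)"])
    have "y + inverse (real (Suc n)) *\<^sub>R (p - y) \<in> X" if "y \<in> X" for y
    proof -
      have "y + inverse (real (Suc n)) *\<^sub>R (p - y)
          = (1 - inverse (real (Suc n))) *\<^sub>R y + inverse (real (Suc n)) *\<^sub>R p"
        by (simp add: algebra_simps)
      also have "\<dots> \<in> X" by (rule convexD[OF X(2) that p]) (auto simp: field_simps)
      finally show ?thesis .
    qed
    then have "continuous_on X (\<lambda>y. R (y + inverse (real (Suc n)) *\<^sub>R (p - y)))"
      by (intro continuous_on_compose2[OF contR] continuous_intros) auto
    with contR show "continuous_on X (\<lambda>y. R p - R y - real (Suc n) *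
      (R (y + inverse (real (Suc n)) *\<^sub>R (p - y)) - R y))"
      by (intro continuous_intros)
  qed
  fix \<omega> assume "\<omega> \<in> space F"
  then have "Y \<omega> \<in> U" using Y(2) X(3) by blast
  then have "R differentiable (at (Y \<omega>))"
    using diff X(4) by (metis differentiable_on_eq_differentiable_at)
  then show "(\<lambda>n. R p - R (Y \<omega>) - real (Suc n) *
      (R (Y \<omega> + inverse (real (Suc n)) *\<^sub>R (p - Y \<omega>)) - R (Y \<omega>))) \<longlonglongrightarrow> bregman R p (Y \<omega>)"
    unfolding bregman_def by (intro tendsto_intros difference_quotient_tendsto_gradient)
qed

section \<open>Elementary bounds for exponentials\<close>

lemma exp_le_quadratic:
  fixes x :: real
  shows "exp x \<le> 1 + x + x\<^sup>2 * exp \<bar>x\<bar>"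
proof -
  obtain t where t: "\<bar>t\<bar> \<le> \<bar>x\<bar>" "exp x = (\<Sum>m<2. (x ^ m) / fact m) + (exp t / fact 2) * x ^ 2"
    using Maclaurin_exp_le[of x 2] by blast
  have "exp x = 1 + x + exp t / 2 * x\<^sup>2" using t(2) by (simp add: numeral_2_eq_2)
  moreover have "exp t / 2 * x\<^sup>2 \<le> exp \<bar>x\<bar> * x\<^sup>2"
  proof (rule mult_right_mono)
    have "exp t \<le> exp \<bar>x\<bar>" using t(1) by simp
    then show "exp t / 2 \<le> exp \<bar>x\<bar>" using exp_gt_zero[of t] by linarith
  qed simp
  ultimately show ?thesis by (simp add: mult.commute)
qed

text \<open>The norm is at most \<open>CARD('n)\<close> times the largest coordinate in absolute value, so exponential
  moments of the norm reduce to those of single coordinates.\<close>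

lemma exp_norm_le_sum_exp:
  fixes z :: "real ^ 'n"
  assumes "s \<ge> 0"
  shows "exp (s * norm z) \<le>
    (\<Sum>i\<in>UNIV. exp (s * CARD('n) * z $ i) + exp (- (s * CARD('n)) * z $ i))"
proof -
  obtain j where j: "\<And>i. \<bar>z $ i\<bar> \<le> \<bar>z $ j\<bar>"
  proof -
    have "finite (range (\<lambda>i. \<bar>z $ i\<bar>))" by simp
    from Max_in[OF this] obtain j where "Max (range (\<lambda>i. \<bar>z $ i\<bar>)) = \<bar>z $ j\<bar>" by blast
    then show ?thesis using that[of j] Max_ge[of "range (\<lambda>i. \<bar>z $ i\<bar>)"] by fastforce
  qed
  have "norm z \<le> (\<Sum>i\<in>UNIV. \<bar>z $ i\<bar>)" by (rule norm_le_l1_cart)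
  also have "\<dots> \<le> (\<Sum>i\<in>(UNIV :: 'n set). \<bar>z $ j\<bar>)" by (intro sum_mono j)
  finally have "s * norm z \<le> s * (CARD('n) * \<bar>z $ j\<bar>)" using assms by (intro mult_left_mono) auto
  also have "\<dots> = s * CARD('n) * \<bar>z $ j\<bar>" by simp
  finally have "exp (s * norm z) \<le> exp (s * CARD('n) * \<bar>z $ j\<bar>)" by simp
  also have "\<dots> \<le> exp (s * CARD('n) * z $ j) + exp (- (s * CARD('n)) * z $ j)"
    by (cases "z $ j \<ge> 0") auto
  also have "\<dots> \<le> (\<Sum>i\<in>UNIV. exp (s * CARD('n) * z $ i) + exp (- (s * CARD('n)) * z $ i))"
    by (rule member_le_sum[of j UNIV "\<lambda>i. exp (s * CARD('n) * z $ i) + exp (- (s * CARD('n)) * z $ i)"])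
      (auto intro: add_nonneg_nonneg)
  finally show ?thesis .
qed

text \<open>This bounds the one-step factor of the exponential potential: \<open>z\<close> is the noise, \<open>g\<close> the
  subgradient, \<open>v\<close> points from the iterate to the minimiser and \<open>e\<close> is the displacement of the
  step; put \<open>P = 1 + H + norm z\<close>. Maximising over \<open>norm e\<close> shows that the last two terms of the
  exponent contribute at most \<open>(\<alpha> * P)\<^sup>2 / (4 * c)\<close>, which is of second order in \<open>\<alpha>\<close>; bounding
  \<open>norm e\<close> by \<open>d\<close> shows that they contribute at most \<open>\<alpha> * P * d\<close>, so that the exponent in the
  remainder grows only linearly in \<open>norm z\<close>.\<close>

lemma exp_step_bound:
  fixes a c d H :: real
  assumes "c > 0" "d \<ge> 0" "a \<ge> 0" "H \<ge> 0"
  defines "s \<equiv> 2 * a * d + 1"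
  defines "C \<equiv> 2 * (1 / (4 * c) + 4 * d\<^sup>2) * exp (s * (1 + H))"
  fixes z g v e :: "'a::real_inner"
  assumes \<alpha>: "0 \<le> \<alpha>" "\<alpha> \<le> a" and g: "norm g \<le> H" and v: "norm v \<le> d" and e: "norm e \<le> d"
  shows "exp (\<alpha> * (z \<bullet> v) + (\<alpha> * ((g + z) \<bullet> e) - c * (norm e)\<^sup>2))
    \<le> 1 + \<alpha> * (z \<bullet> v) + C * \<alpha>\<^sup>2 * exp (s * norm z)"
proof -
  define P where "P = 1 + H + norm z"
  have P: "P \<ge> 1" unfolding P_def using assms by simp
  define y where "y = \<alpha> * (z \<bullet> v)"
  \<comment> \<open>Truncation at \<open>0\<close> loses nothing for an upper bound and makes \<open>r\<close> itself of order \<open>\<alpha>\<close>, which the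
    untruncated difference is not.\<close>
  define r where "r = max 0 (\<alpha> * ((g + z) \<bullet> e) - c * (norm e)\<^sup>2)"
  have w: "norm (g + z) \<le> P" unfolding P_def using norm_triangle_ineq[of g z] g by linarith
  have we: "\<alpha> * ((g + z) \<bullet> e) \<le> \<alpha> * (P * norm e)"
    by (intro mult_left_mono order_trans[OF norm_cauchy_schwarz] mult_right_mono w \<alpha> norm_ge_zero)
  have r0: "0 \<le> r" unfolding r_def by simp
  have r1: "r \<le> \<alpha> * P * d"
  proof -
    have "\<alpha> * (P * norm e) \<le> \<alpha> * (P * d)" using \<alpha> P e by (intro mult_left_mono) auto
    moreover have "0 \<le> c * (norm e)\<^sup>2" "0 \<le> \<alpha> * (P * d)" using assms P by auto
    ultimately show ?thesis unfolding r_def using we by (simp add: mult.assoc)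
  qed
  have r2: "r \<le> (\<alpha> * P)\<^sup>2 / (4 * c)"
  proof -
    have "0 \<le> (\<alpha> * P - 2 * c * norm e)\<^sup>2" by simp
    then have "4 * c * (\<alpha> * (P * norm e) - c * (norm e)\<^sup>2) \<le> (\<alpha> * P)\<^sup>2"
      by (simp add: power2_eq_square algebra_simps)
    then have "\<alpha> * (P * norm e) - c * (norm e)\<^sup>2 \<le> (\<alpha> * P)\<^sup>2 / (4 * c)"
      using \<open>c > 0\<close> by (simp add: field_simps)
    moreover have "0 \<le> (\<alpha> * P)\<^sup>2 / (4 * c)" using \<open>c > 0\<close> by simp
    ultimately show ?thesis unfolding r_def using we by simp
  qed
  have y1: "\<bar>y\<bar> \<le> \<alpha> * P * d"
  proof -
    have "\<bar>z \<bullet> v\<bar> \<le> norm z * norm v" by (rule Cauchy_Schwarz_ineq2)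
    also have "\<dots> \<le> P * d" unfolding P_def using assms by (intro mult_mono) auto
    finally show ?thesis
      unfolding y_def using \<alpha> by (simp add: abs_mult mult.assoc mult_left_mono)
  qed
  have yr: "\<bar>y + r\<bar> \<le> 2 * (\<alpha> * P * d)" using y1 r1 r0 by linarith
  have "(y + r)\<^sup>2 \<le> (2 * (\<alpha> * P * d))\<^sup>2" using yr by (metis abs_le_square_iff abs_of_nonneg abs_ge_zero order_trans)
  moreover have "exp \<bar>y + r\<bar> \<le> exp (2 * a * d * P)"
  proof -
    have "\<alpha> * (P * d) \<le> a * (P * d)" using \<alpha> P assms by (intro mult_right_mono) auto
    then show ?thesis using yr by (simp add: algebra_simps)
  qed
  ultimately have sq: "(y + r)\<^sup>2 * exp \<bar>y + r\<bar> \<le> (2 * (\<alpha> * P * d))\<^sup>2 * exp (2 * a * d * P)"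
    by (intro mult_mono) auto
  have PP: "P\<^sup>2 \<le> 2 * exp P"
    using exp_lower_Taylor_quadratic[of P] P by simp
  have exp1: "1 \<le> exp (2 * a * d * P)" using assms P by simp
  have "exp (\<alpha> * (z \<bullet> v) + (\<alpha> * ((g + z) \<bullet> e) - c * (norm e)\<^sup>2)) \<le> exp (y + r)"
    unfolding y_def r_def by simp
  also have "\<dots> \<le> 1 + (y + r) + (y + r)\<^sup>2 * exp \<bar>y + r\<bar>" by (rule exp_le_quadratic)
  also have "\<dots> \<le> 1 + y + ((\<alpha> * P)\<^sup>2 / (4 * c) * exp (2 * a * d * P)
      + (2 * (\<alpha> * P * d))\<^sup>2 * exp (2 * a * d * P))"
  proof -
    have "(\<alpha> * P)\<^sup>2 / (4 * c) * 1 \<le> (\<alpha> * P)\<^sup>2 / (4 * c) * exp (2 * a * d * P)"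
      using exp1 \<open>c > 0\<close> by (intro mult_left_mono) auto
    then show ?thesis using r2 sq by linarith
  qed
  also have "\<dots> = 1 + y + \<alpha>\<^sup>2 * (1 / (4 * c) + 4 * d\<^sup>2) * exp (2 * a * d * P) * P\<^sup>2"
    by (simp add: power_mult_distrib algebra_simps add_divide_distrib)
  also have "\<dots> \<le> 1 + y + \<alpha>\<^sup>2 * (1 / (4 * c) + 4 * d\<^sup>2) * exp (2 * a * d * P) * (2 * exp P)"
    using PP \<open>c > 0\<close> by (intro add_left_mono mult_left_mono) auto
  also have "\<dots> = 1 + y + C * \<alpha>\<^sup>2 * exp (s * norm z)"
  proof -
    have "exp (2 * a * d * P) * exp P = exp (s * (1 + H)) * exp (s * norm z)"
      unfolding s_def P_def exp_add[symmetric] by (simp add: algebra_simps)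
    then have "\<alpha>\<^sup>2 * (1 / (4 * c) + 4 * d\<^sup>2) * 2 * (exp (2 * a * d * P) * exp P)
        = \<alpha>\<^sup>2 * (1 / (4 * c) + 4 * d\<^sup>2) * 2 * (exp (s * (1 + H)) * exp (s * norm z))" by simp
    then show ?thesis unfolding C_def by (simp only: mult_ac)
  qed
  finally show ?thesis unfolding y_def .
qed

section \<open>Integrals controlled by conditional expectations\<close>

lemma (in finite_measure_subalgebra) integral_mult_le_of_cond_exp_le:
  fixes W E :: "'a \<Rightarrow> real"
  assumes W[measurable]: "W \<in> borel_measurable F" and W0: "\<And>\<omega>. \<omega> \<in> space M \<Longrightarrow> 0 \<le> W \<omega>"
    and W1: "\<And>\<omega>. \<omega> \<in> space M \<Longrightarrow> W \<omega> \<le> w"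
    and E[measurable]: "E \<in> borel_measurable M" and E0: "\<And>\<omega>. 0 \<le> E \<omega>"
    and cond: "AE \<omega> in M. nn_cond_exp M F (\<lambda>\<omega>. ennreal (E \<omega>)) \<omega> \<le> ennreal c" and c: "c \<ge> 0"
  shows "integrable M (\<lambda>\<omega>. W \<omega> * E \<omega>)"
    and "(\<integral>\<omega>. W \<omega> * E \<omega> \<partial>M) \<le> c * (\<integral>\<omega>. W \<omega> \<partial>M)"
proof -
  have WM[measurable]: "W \<in> borel_measurable M" by (rule measurable_from_subalg[OF subalg W])
  have intW: "integrable M W"
    using W0 W1 by (intro integrable_const_bound[of _ w]) (auto intro!: AE_I2)
  have "(\<integral>\<^sup>+\<omega>. ennreal (W \<omega> * E \<omega>) \<partial>M) = (\<integral>\<^sup>+\<omega>. ennreal (W \<omega>) * ennreal (E \<omega>) \<partial>M)"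
    by (intro nn_integral_cong ennreal_mult W0 E0)
  also have "\<dots> = (\<integral>\<^sup>+\<omega>. ennreal (W \<omega>) * nn_cond_exp M F (\<lambda>\<omega>. ennreal (E \<omega>)) \<omega> \<partial>M)"
    by (rule nn_cond_exp_intg[symmetric]) measurable
  also have "\<dots> \<le> (\<integral>\<^sup>+\<omega>. ennreal (W \<omega>) * ennreal c \<partial>M)"
  proof (rule nn_integral_mono_AE)
    show "AE \<omega> in M. ennreal (W \<omega>) * nn_cond_exp M F (\<lambda>\<omega>. ennreal (E \<omega>)) \<omega> \<le> ennreal (W \<omega>) * ennreal c"
      using cond by eventually_elim (auto intro: mult_left_mono)
  qed
  also have "\<dots> = (\<integral>\<^sup>+\<omega>. ennreal (c * W \<omega>) \<partial>M)"
    using c W0 by (intro nn_integral_cong) (simp add: ennreal_mult mult.commute)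
  also have "\<dots> = ennreal (\<integral>\<omega>. c * W \<omega> \<partial>M)"
    using c W0 intW by (intro nn_integral_eq_integral) (auto intro!: AE_I2)
  finally have le: "(\<integral>\<^sup>+\<omega>. ennreal (W \<omega> * E \<omega>) \<partial>M) \<le> ennreal (c * (\<integral>\<omega>. W \<omega> \<partial>M))" by simp
  have WE0: "AE \<omega> in M. 0 \<le> W \<omega> * E \<omega>" using W0 E0 by (auto intro!: AE_I2)
  show int: "integrable M (\<lambda>\<omega>. W \<omega> * E \<omega>)"
    by (rule integrableI_nonneg[OF _ WE0]) (use le in \<open>auto simp: less_top[symmetric] top_unique\<close>)
  have "ennreal (\<integral>\<omega>. W \<omega> * E \<omega> \<partial>M) \<le> ennreal (c * (\<integral>\<omega>. W \<omega> \<partial>M))"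
    using le nn_integral_eq_integral[OF int WE0] by simp
  moreover have "0 \<le> c * (\<integral>\<omega>. W \<omega> \<partial>M)"
    using c W0 by (intro mult_nonneg_nonneg Bochner_Integration.integral_nonneg) auto
  ultimately show "(\<integral>\<omega>. W \<omega> * E \<omega> \<partial>M) \<le> c * (\<integral>\<omega>. W \<omega> \<partial>M)" by simp
qed

lemma (in finite_measure_subalgebra) integral_mult_centered:
  fixes V Y h :: "'a \<Rightarrow> real"
  assumes h: "integrable M h"
    and V[measurable]: "V \<in> borel_measurable F" and V1: "\<And>\<omega>. \<omega> \<in> space M \<Longrightarrow> \<bar>V \<omega>\<bar> \<le> w"
    and Y[measurable]: "Y \<in> borel_measurable M"
    and YE: "AE \<omega> in M. Y \<omega> = h \<omega> - real_cond_exp M F h \<omega>"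
  shows "integrable M (\<lambda>\<omega>. V \<omega> * Y \<omega>)" and "(\<integral>\<omega>. V \<omega> * Y \<omega> \<partial>M) = 0"
proof -
  have VM[measurable]: "V \<in> borel_measurable M" by (rule measurable_from_subalg[OF subalg V])
  have hM[measurable]: "h \<in> borel_measurable M" using h by simp
  have 1: "integrable M (\<lambda>\<omega>. V \<omega> * h \<omega>)"
  proof (rule Bochner_Integration.integrable_bound[of M "\<lambda>\<omega>. w * h \<omega>"])
    have "\<bar>V \<omega>\<bar> * \<bar>h \<omega>\<bar> \<le> \<bar>w\<bar> * \<bar>h \<omega>\<bar>" if "\<omega> \<in> space M" for \<omega>
      using V1[OF that] by (intro mult_right_mono) auto
    then show "AE \<omega> in M. norm (V \<omega> * h \<omega>) \<le> norm (w * h \<omega>)" by (auto intro!: AE_I2 simp: abs_mult)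
  qed (use h in auto)
  note 2 = real_cond_exp_intg[OF 1 V hM]
  have eq: "AE \<omega> in M. V \<omega> * h \<omega> - V \<omega> * real_cond_exp M F h \<omega> = V \<omega> * Y \<omega>"
    using YE by eventually_elim (simp add: right_diff_distrib)
  have "integrable M (\<lambda>\<omega>. V \<omega> * h \<omega> - V \<omega> * real_cond_exp M F h \<omega>)"
    using 1 2(1) by (rule Bochner_Integration.integrable_diff)
  then show "integrable M (\<lambda>\<omega>. V \<omega> * Y \<omega>)"
    by (rule integrable_cong_AE[THEN iffD1, rotated 3]) (use eq in auto)
  have "(\<integral>\<omega>. V \<omega> * Y \<omega> \<partial>M) = (\<integral>\<omega>. V \<omega> * h \<omega> - V \<omega> * real_cond_exp M F h \<omega> \<partial>M)"
    by (rule integral_cong_AE) (use eq in auto)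
  also have "\<dots> = 0" using 1 2 by simp
  finally show "(\<integral>\<omega>. V \<omega> * Y \<omega> \<partial>M) = 0" .
qed

text \<open>The factor of \<open>exp_step_bound\<close>, integrated against a weight that is known before the step: the
  linear term vanishes because \<open>Z\<close> is centred given \<open>F\<close>, and each of the \<open>2 * CARD('n)\<close> coordinate
  exponentials that dominate the remainder costs at most \<open>c\<close>.\<close>

lemma (in finite_measure_subalgebra) integral_mult_linear_exp_le:
  fixes W :: "'a \<Rightarrow> real" and V Z h :: "'a \<Rightarrow> real ^ 'n" and s c C \<alpha> :: real
  assumes W[measurable]: "W \<in> borel_measurable F" and W0: "\<And>\<omega>. \<omega> \<in> space M \<Longrightarrow> 0 \<le> W \<omega>"
    and W1: "\<And>\<omega>. \<omega> \<in> space M \<Longrightarrow> W \<omega> \<le> w"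
    and V[measurable]: "V \<in> borel_measurable F" and V1: "\<And>\<omega>. \<omega> \<in> space M \<Longrightarrow> norm (V \<omega>) \<le> d"
    and h: "\<And>i. integrable M (\<lambda>\<omega>. h \<omega> $ i)"
    and Z[measurable]: "Z \<in> borel_measurable M"
    and ZE: "AE \<omega> in M. Z \<omega> = h \<omega> - vec_cond_exp M F h \<omega>"
    and cond: "\<And>i. AE \<omega> in M. nn_cond_exp M F (\<lambda>\<omega>. ennreal (exp (s * CARD('n) * Z \<omega> $ i))) \<omega> \<le> ennreal c"
      "\<And>i. AE \<omega> in M. nn_cond_exp M F (\<lambda>\<omega>. ennreal (exp (- (s * CARD('n)) * Z \<omega> $ i))) \<omega> \<le> ennreal c"
    and s: "s \<ge> 0" and c: "c \<ge> 0" and C: "C \<ge> 0"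
  shows "integrable M (\<lambda>\<omega>. W \<omega> * (1 + \<alpha> * (Z \<omega> \<bullet> V \<omega>) + C * exp (s * norm (Z \<omega>))))" (is "integrable M ?I")
    and "(\<integral>\<omega>. W \<omega> * (1 + \<alpha> * (Z \<omega> \<bullet> V \<omega>) + C * exp (s * norm (Z \<omega>))) \<partial>M)
      \<le> (1 + C * (2 * CARD('n) * c)) * (\<integral>\<omega>. W \<omega> \<partial>M)"
proof -
  have WM[measurable]: "W \<in> borel_measurable M" by (rule measurable_from_subalg[OF subalg W])
  have VM[measurable]: "V \<in> borel_measurable M" by (rule measurable_from_subalg[OF subalg V])
  have intW: "integrable M W"
    using W0 W1 by (intro integrable_const_bound[of _ w]) (auto intro!: AE_I2)
  have mz[measurable]: "(\<lambda>\<omega>. Z \<omega> $ i) \<in> borel_measurable M" for i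
    by (rule measurable_compose[OF Z borel_measurable_nth])
  have lin: "integrable M (\<lambda>\<omega>. (W \<omega> * V \<omega> $ i) * Z \<omega> $ i)" "(\<integral>\<omega>. (W \<omega> * V \<omega> $ i) * Z \<omega> $ i \<partial>M) = 0" for i
  proof -
    have m: "(\<lambda>\<omega>. W \<omega> * V \<omega> $ i) \<in> borel_measurable F"
      by (intro borel_measurable_times W measurable_compose[OF V borel_measurable_nth])
    have b: "\<bar>W \<omega> * V \<omega> $ i\<bar> \<le> w * d" if "\<omega> \<in> space M" for \<omega>
      unfolding abs_mult
      using W0[OF that] W1[OF that] V1[OF that] component_le_norm_cart[of "V \<omega>" i]
      by (intro mult_mono) auto
    have e: "AE \<omega> in M. Z \<omega> $ i = h \<omega> $ i - real_cond_exp M F (\<lambda>\<omega>. h \<omega> $ i) \<omega>"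
      using ZE by eventually_elim (simp add: vec_cond_exp_def)
    show "integrable M (\<lambda>\<omega>. (W \<omega> * V \<omega> $ i) * Z \<omega> $ i)" "(\<integral>\<omega>. (W \<omega> * V \<omega> $ i) * Z \<omega> $ i \<partial>M) = 0"
      using integral_mult_centered[OF h m b mz e] by auto
  qed
  have linsum: "W \<omega> * (\<alpha> * (Z \<omega> \<bullet> V \<omega>)) = \<alpha> * (\<Sum>i\<in>UNIV. (W \<omega> * V \<omega> $ i) * Z \<omega> $ i)" for \<omega>
    unfolding inner_vec_def by (simp add: sum_distrib_left algebra_simps)
  define E1 where "E1 i \<omega> = exp (s * CARD('n) * Z \<omega> $ i)" for i \<omega>
  define E2 where "E2 i \<omega> = exp (- (s * CARD('n)) * Z \<omega> $ i)" for i \<omega>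
  have m1: "E1 i \<in> borel_measurable M" "E2 i \<in> borel_measurable M" for i
    unfolding E1_def E2_def by measurable
  have e1: "integrable M (\<lambda>\<omega>. W \<omega> * E1 i \<omega>)" "(\<integral>\<omega>. W \<omega> * E1 i \<omega> \<partial>M) \<le> c * (\<integral>\<omega>. W \<omega> \<partial>M)" for i
    by (rule integral_mult_le_of_cond_exp_le[OF W W0 W1 m1(1) _ _ c];
        use cond(1)[of i] in \<open>simp add: E1_def\<close>)+
  have e2: "integrable M (\<lambda>\<omega>. W \<omega> * E2 i \<omega>)" "(\<integral>\<omega>. W \<omega> * E2 i \<omega> \<partial>M) \<le> c * (\<integral>\<omega>. W \<omega> \<partial>M)" for i
    by (rule integral_mult_le_of_cond_exp_le[OF W W0 W1 m1(2) _ _ c];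
        use cond(2)[of i] in \<open>simp add: E2_def\<close>)+
  define J where "J \<omega> = W \<omega> + (\<alpha> * (\<Sum>i\<in>UNIV. (W \<omega> * V \<omega> $ i) * Z \<omega> $ i)
      + C * (\<Sum>i\<in>UNIV. W \<omega> * E1 i \<omega> + W \<omega> * E2 i \<omega>))" for \<omega>
  have intJ: "integrable M J"
    unfolding J_def using intW lin(1) e1(1) e2(1)
    by (intro Bochner_Integration.integrable_add integrable_mult_right Bochner_Integration.integrable_sum) auto
  have J: "(\<integral>\<omega>. J \<omega> \<partial>M) = (\<integral>\<omega>. W \<omega> \<partial>M)
      + C * (\<Sum>i\<in>UNIV. (\<integral>\<omega>. W \<omega> * E1 i \<omega> \<partial>M) + (\<integral>\<omega>. W \<omega> * E2 i \<omega> \<partial>M))"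
    unfolding J_def using intW lin e1(1) e2(1) by (simp add: Bochner_Integration.integral_sum)
  have IJ: "?I \<omega> \<le> J \<omega>" if "\<omega> \<in> space M" for \<omega>
  proof -
    have "W \<omega> * (C * exp (s * norm (Z \<omega>))) \<le> W \<omega> * (C * (\<Sum>i\<in>UNIV. E1 i \<omega> + E2 i \<omega>))"
      unfolding E1_def E2_def
      by (intro mult_left_mono exp_norm_le_sum_exp W0 that C s)
    also have "\<dots> = C * (\<Sum>i\<in>UNIV. W \<omega> * E1 i \<omega> + W \<omega> * E2 i \<omega>)"
      by (simp add: sum_distrib_left algebra_simps)
    finally show ?thesis unfolding J_def linsum[symmetric] by (simp add: algebra_simps)
  qed
  show intI: "integrable M ?I"
  proof (rule Bochner_Integration.integrable_bound)
    show "integrable M (\<lambda>\<omega>. \<bar>J \<omega>\<bar> + 2 * \<bar>\<alpha> * (\<Sum>i\<in>UNIV. (W \<omega> * V \<omega> $ i) * Z \<omega> $ i)\<bar>)"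
      using intJ lin(1)
      by (intro Bochner_Integration.integrable_add integrable_mult_right integrable_abs
          Bochner_Integration.integrable_sum) auto
    have "\<bar>?I \<omega>\<bar> \<le> \<bar>J \<omega>\<bar> + 2 * \<bar>\<alpha> * (\<Sum>i\<in>UNIV. (W \<omega> * V \<omega> $ i) * Z \<omega> $ i)\<bar>"
      if "\<omega> \<in> space M" for \<omega>
    proof -
      have "0 \<le> W \<omega> * (C * exp (s * norm (Z \<omega>)))" using W0[OF that] C by auto
      moreover have "?I \<omega> = W \<omega> + W \<omega> * (\<alpha> * (Z \<omega> \<bullet> V \<omega>)) + W \<omega> * (C * exp (s * norm (Z \<omega>)))"
        by (simp add: algebra_simps)
      ultimately show ?thesis
        using IJ[OF that] W0[OF that] linsum[of \<omega>] by linarith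
    qed
    then show "AE \<omega> in M. norm (?I \<omega>)
      \<le> norm (\<bar>J \<omega>\<bar> + 2 * \<bar>\<alpha> * (\<Sum>i\<in>UNIV. (W \<omega> * V \<omega> $ i) * Z \<omega> $ i)\<bar>)"
      by (intro AE_I2) fastforce
  qed measurable
  have "(\<integral>\<omega>. ?I \<omega> \<partial>M) \<le> (\<integral>\<omega>. J \<omega> \<partial>M)"
    by (rule integral_mono[OF intI intJ IJ])
  also have "\<dots> \<le> (\<integral>\<omega>. W \<omega> \<partial>M) + C * (\<Sum>i\<in>(UNIV :: 'n set). c * (\<integral>\<omega>. W \<omega> \<partial>M) + c * (\<integral>\<omega>. W \<omega> \<partial>M))"
    unfolding J by (intro add_left_mono mult_left_mono sum_mono add_mono e1 e2 C)
  also have "\<dots> = (1 + C * (2 * CARD('n) * c)) * (\<integral>\<omega>. W \<omega> \<partial>M)"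
    by (simp add: algebra_simps)
  finally show "(\<integral>\<omega>. ?I \<omega> \<partial>M) \<le> (1 + C * (2 * CARD('n) * c)) * (\<integral>\<omega>. W \<omega> \<partial>M)" .
qed

lemma integrable_of_cond_exp_moments:
  fixes \<zeta> :: "'w \<Rightarrow> real ^ 'n"
  assumes "finite_measure_subalgebra M F"
    and \<zeta>[measurable]: "\<zeta> \<in> borel_measurable M"
    and cond: "\<And>s :: real. AE \<omega> in M. nn_cond_exp M F (\<lambda>\<omega>. ennreal (exp (s * \<zeta> \<omega> $ i))) \<omega> \<le> ennreal (c s)"
    and c: "\<And>s. c s \<ge> 0"
  shows "integrable M (\<lambda>\<omega>. \<zeta> \<omega> $ i)"
proof -
  interpret finite_measure_subalgebra M F by fact
  have [measurable]: "(\<lambda>\<omega>. \<zeta> \<omega> $ i) \<in> borel_measurable M"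
    by (rule measurable_compose[OF \<zeta> borel_measurable_nth])
  have exp_int: "integrable M (\<lambda>\<omega>. exp (s * \<zeta> \<omega> $ i))" for s :: real
    using integral_mult_le_of_cond_exp_le(1)[of "\<lambda>_. 1" 1 "\<lambda>\<omega>. exp (s * \<zeta> \<omega> $ i)" "c s"] cond[of s] c
    by simp
  show ?thesis
  proof (rule Bochner_Integration.integrable_bound)
    show "integrable M (\<lambda>\<omega>. exp (1 * \<zeta> \<omega> $ i) + exp ((-1) * \<zeta> \<omega> $ i))"
      by (rule Bochner_Integration.integrable_add[OF exp_int exp_int])
    have "\<bar>u\<bar> \<le> exp u + exp (- u)" for u :: real
      using exp_ge_add_one_self[of u] exp_ge_add_one_self[of "- u"] exp_gt_zero[of u] exp_gt_zero[of "- u"]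
      by linarith
    then show "AE \<omega> in M. norm (\<zeta> \<omega> $ i) \<le> norm (exp (1 * \<zeta> \<omega> $ i) + exp ((-1) * \<zeta> \<omega> $ i))"
      by (intro AE_I2) (simp add: add_nonneg_nonneg)
  qed measurable
qed

section \<open>The filtration generated by the iterates\<close>

lemma space_history: "space (history M x t) = space M"
  unfolding history_def by (rule space_measure_of) auto

lemma sets_history: "sets (history M x t) =
  sigma_sets (space M) (\<Union>s\<in>{1..t}. {x s -` A \<inter> space M | A. A \<in> sets borel})"
  unfolding history_def by (rule sets_measure_of) auto

lemma measurable_history:
  assumes "1 \<le> s" "s \<le> t"
  shows "x s \<in> borel_measurable (history M x t)"
proof (rule measurableI)
  fix A :: "'b set" assume "A \<in> sets borel"
  then show "x s -` A \<inter> space (history M x t) \<in> sets (history M x t)"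
    unfolding space_history sets_history using assms
    by (intro sigma_sets.Basic UN_I[of s]) auto
qed simp

lemma subalgebra_history:
  assumes "\<And>s. 1 \<le> s \<Longrightarrow> x s \<in> borel_measurable M"
  shows "subalgebra M (history M x t)"
  unfolding subalgebra_def space_history sets_history
  using assms by (auto intro!: sets.sigma_sets_subset measurable_sets)

section \<open>Exponential moments of the weighted suboptimality\<close>

lemma exp_recursion_le:
  fixes u \<beta> :: "nat \<Rightarrow> real"
  assumes step: "\<And>k. k \<ge> 1 \<Longrightarrow> u (Suc k) \<le> exp (\<beta> k) * u k"
    and sum: "summable (\<lambda>k. \<beta> (Suc k))" and \<beta>: "\<And>k. k \<ge> 1 \<Longrightarrow> \<beta> k \<ge> 0" and u1: "u 1 \<ge> 0"
  shows "u (Suc t) \<le> exp (\<Sum>k. \<beta> (Suc k)) * u 1"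
proof -
  have "u (Suc t) \<le> exp (\<Sum>k<t. \<beta> (Suc k)) * u 1"
  proof (induction t)
    case (Suc t)
    have "u (Suc (Suc t)) \<le> exp (\<beta> (Suc t)) * u (Suc t)" by (rule step) simp
    also have "\<dots> \<le> exp (\<beta> (Suc t)) * (exp (\<Sum>k<t. \<beta> (Suc k)) * u 1)"
      using Suc by (intro mult_left_mono) auto
    finally show ?case by (simp add: exp_add mult_ac)
  qed simp
  also have "\<dots> \<le> exp (\<Sum>k. \<beta> (Suc k)) * u 1"
    using sum_le_suminf[OF sum, of "{..<t}"] \<beta> u1 by (intro mult_right_mono) auto
  finally show ?thesis .
qed

text \<open>The expectation of the potential \<open>\<Phi>\<close> satisfies a multiplicative recursion with summable
  exponents \<open>\<beta>\<close>. All geometric quantities are measured in the Euclidean norm, through constants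
  \<open>m\<close> and \<open>L\<close> of equivalence with \<open>N\<close>.\<close>

lemma mirror_descent_exponential_moment:
  fixes N :: "real ^ 'n \<Rightarrow> real"
    and X U :: "(real ^ 'n) set"
    and f R :: "real ^ 'n \<Rightarrow> real"
    and M :: "'w measure"
    and x gt g b \<zeta> :: "nat \<Rightarrow> 'w \<Rightarrow> real ^ 'n"
    and \<alpha> B :: "nat \<Rightarrow> real"
  assumes norm_N: "is_norm N"
    and X: "convex X" "compact X" and p: "p \<in> X"
    and f: "continuous_on X f"
    and G: "G > 0" "\<forall>y\<in>X. \<forall>h\<in>subdifferential f y. dual_norm N h \<le> G"
    and R: "\<sigma> > 0" "open U" "X \<subseteq> U" "strongly_convex_on U N \<sigma> R" "R differentiable_on U"
    and M: "prob_space M"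
    and step_pos: "\<forall>t\<ge>1. \<alpha> t > 0"
    and rv: "\<forall>t\<ge>1. x t \<in> borel_measurable M"
      "\<forall>t\<ge>1. gt t \<in> borel_measurable M"
      "\<forall>t\<ge>1. g t \<in> borel_measurable M"
    and initial: "\<forall>\<omega>\<in>space M. x 1 \<omega> \<in> X"
    and iterates: "\<forall>t\<ge>1. \<forall>\<omega>\<in>space M.
      is_arg_min (\<lambda>u. gt t \<omega> \<bullet> (u - x t \<omega>) + 1 / \<alpha> t * bregman R u (x t \<omega>)) (\<lambda>u. u \<in> X) (x (t + 1) \<omega>)"
    and bias_measurable: "\<forall>t\<ge>1. b t \<in> borel_measurable (history M x t)"
    and subgradient: "\<forall>t\<ge>1. AE \<omega> in M. g t \<omega> \<in> subdifferential f (x t \<omega>)"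
    and mean: "\<forall>t\<ge>1. AE \<omega> in M. vec_cond_exp M (history M x t) (gt t) \<omega> = g t \<omega> + b t \<omega>"
    and noise: "\<zeta> = (\<lambda>t \<omega>. gt t \<omega> - g t \<omega> - b t \<omega>)"
    and sq_summable: "summable (\<lambda>k. (\<alpha> (Suc k))\<^sup>2)"
    and bias: "\<forall>t\<ge>1. B t \<ge> 0"
      "\<forall>t\<ge>1. AE \<omega> in M. dual_norm N (b t \<omega>) \<le> B t"
      "summable (\<lambda>k. \<alpha> (Suc k) * B (Suc k))"
    and subgaussian: "\<forall>t\<ge>1. \<forall>v. \<forall>s::real. AE \<omega> in M.
        nn_cond_exp M (history M x t) (\<lambda>\<omega>'. ennreal (exp (s * (v \<bullet> \<zeta> t \<omega>')))) \<omega>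
          \<le> ennreal (exp (1 / 2 * (N v)\<^sup>2 * \<nu>\<^sup>2 * s\<^sup>2))"
  obtains C where "\<And>t. integrable M (\<lambda>\<omega>. exp (\<Sum>k=1..t. \<alpha> k * (f (x k \<omega>) - f p)))"
    "\<And>t. (\<integral>\<omega>. exp (\<Sum>k=1..t. \<alpha> k * (f (x k \<omega>) - f p)) \<partial>M) \<le> C"
proof -
  interpret prob_space M by fact
  obtain L where L: "L > 0" "\<And>v. N v \<le> L * norm v" using is_norm_le_norm[OF norm_N] by blast
  obtain m where m: "m > 0" "\<And>v. m * norm v \<le> N v" using norm_le_is_norm[OF norm_N] by blast
  have dual: "norm v \<le> L * dual_norm N v" for v by (rule norm_le_dual_norm[OF norm_N L(2)])
  obtain d where d: "d \<ge> 0" "\<And>y z. y \<in> X \<Longrightarrow> z \<in> X \<Longrightarrow> norm (y - z) \<le> d"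
  proof -
    obtain r where r: "\<forall>y\<in>X. norm y \<le> r" using compact_imp_bounded[OF X(2)] unfolding bounded_iff by blast
    have "norm (y - z) \<le> 2 * r" if "y \<in> X" "z \<in> X" for y z
      using norm_triangle_ineq4[of y z] r[rule_format, OF that(1)] r[rule_format, OF that(2)] by linarith
    moreover have "0 \<le> 2 * r" using norm_ge_zero[of p] r[rule_format, OF p] by linarith
    ultimately show ?thesis using that by blast
  qed
  obtain Cb where Cb: "\<And>y. y \<in> X \<Longrightarrow> bregman R p y \<le> Cb"
    using bregman_bounded[OF R(4) _ R(2,3) X(2) R(5) p] R(1) less_imp_le by metis
  have diff: "R differentiable (at y)" if "y \<in> X" for y
    using R(2,3,5) that differentiable_on_eq_differentiable_at by blast
  \<comment> \<open>\<open>c\<close> is half a modulus of strong convexity of \<open>R\<close> in the Euclidean norm.\<close>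
  define c where "c = \<sigma> / 2 * m\<^sup>2"
  have c: "c > 0" unfolding c_def using R(1) m(1) by simp
  have breg: "c * (norm (u - y))\<^sup>2 \<le> bregman R u y" if "u \<in> X" "y \<in> X" for u y
  proof -
    have "(m * norm (u - y))\<^sup>2 \<le> (N (u - y))\<^sup>2" using m by (intro power_mono) auto
    then have "\<sigma> / 2 * (m * norm (u - y))\<^sup>2 \<le> \<sigma> / 2 * (N (u - y))\<^sup>2"
      using R(1) by (intro mult_left_mono) auto
    also have "\<dots> \<le> bregman R u y"
      by (rule strongly_convex_bregman_ge[OF R(4) diff[OF that(2)]]) (use that R(3) in auto)
    finally show ?thesis unfolding c_def by (simp add: power_mult_distrib)
  qed
  have breg0: "0 \<le> bregman R p y" if "y \<in> X" for y
    using breg[OF p that] c by (meson less_imp_le mult_nonneg_nonneg order_trans zero_le_power2)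
  have xX: "x k \<omega> \<in> X" if "k \<ge> 1" "\<omega> \<in> space M" for k \<omega>
  proof (cases "k = 1")
    case False
    with that(1) have "k = (k - 1) + 1" "k - 1 \<ge> 1" by auto
    then show ?thesis using iterates that(2) unfolding is_arg_min_linorder by metis
  qed (use initial that in simp)

  \<comment> \<open>Step sizes are square summable, hence bounded.\<close>
  define a where "a = 1 + (\<Sum>k. (\<alpha> (Suc k))\<^sup>2)"
  have a: "\<alpha> k \<le> a" if "k \<ge> 1" for k
  proof -
    obtain j where j: "k = Suc j" using \<open>k \<ge> 1\<close> by (cases k) auto
    have "(\<alpha> k)\<^sup>2 \<le> (\<Sum>k. (\<alpha> (Suc k))\<^sup>2)"
      using sum_le_suminf[OF sq_summable, of "{j}"] unfolding j by simp
    moreover have "\<alpha> k \<le> 1 + (\<alpha> k)\<^sup>2"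
      using zero_le_power2[of "\<alpha> k - 1 / 2"]
      by (simp add: power2_eq_square algebra_simps)
    ultimately show ?thesis unfolding a_def by linarith
  qed
  have a0: "a \<ge> 0" using a[of 1] step_pos by fastforce
  \<comment> \<open>The constants of \<open>exp_step_bound\<close>; \<open>e\<close> is the sub-Gaussian bound for the coordinate exponentials
    at the parameter that \<open>exp_norm_le_sum_exp\<close> requires.\<close>
  define s where "s = 2 * a * d + 1"
  have s0: "s \<ge> 0" unfolding s_def using a0 d(1) by simp
  define H where "H = L * G"
  define C1 where "C1 = 2 * (1 / (4 * c) + 4 * d\<^sup>2) * exp (s * (1 + H))"
  have C1: "C1 \<ge> 0" unfolding C1_def using c by simp
  define e where "e = exp (1 / 2 * L\<^sup>2 * \<nu>\<^sup>2 * (s * CARD('n))\<^sup>2)"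
  define C2 where "C2 = C1 * (2 * CARD('n) * e)"
  have C2: "C2 \<ge> 0" unfolding C2_def e_def using C1 by simp
  define \<Phi> where "\<Phi> k \<omega> = exp (bregman R p (x k \<omega>) + (\<Sum>j=1..<k. \<alpha> j * (f (x j \<omega>) - f p)))" for k \<omega>

  have sub: "finite_measure_subalgebra M (history M x t)" for t
    by unfold_locales (rule subalgebra_history, use rv in blast)
  have \<Phi>F: "\<Phi> k \<in> borel_measurable (history M x k)" if "k \<ge> 1" for k
  proof -
    have xm: "x j \<in> borel_measurable (history M x k)" if "1 \<le> j" "j \<le> k" for j
      using that by (rule measurable_history)
    have xin: "x j \<omega> \<in> X" if "1 \<le> j" "\<omega> \<in> space (history M x k)" for j \<omega>
      using xX that by (simp add: space_history)
    have "(\<lambda>\<omega>. bregman R p (x k \<omega>)) \<in> borel_measurable (history M x k)"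
      by (rule measurable_bregman[OF xm xin compact_imp_closed[OF X(2)] X(1) R(3,2,5) p]) (use that in auto)
    moreover have "(\<lambda>\<omega>. f (x j \<omega>)) \<in> borel_measurable (history M x k)" if "j \<in> {1..<k}" for j
      by (rule measurable_continuous_compose_in[OF xm xin compact_imp_closed[OF X(2)] f]) (use that in auto)
    ultimately show ?thesis unfolding \<Phi>_def
      by (intro borel_measurable_exp[THEN measurable_compose[rotated]] borel_measurable_add borel_measurable_sum
          borel_measurable_times borel_measurable_diff borel_measurable_const)
  qed
  have \<Phi>M: "\<Phi> k \<in> borel_measurable M" if "k \<ge> 1" for k
    using measurable_from_subalg[OF finite_measure_subalgebra.subalg[OF sub] \<Phi>F[OF that]] .
  obtain Cf where Cf: "\<And>y. y \<in> X \<Longrightarrow> \<bar>f y - f p\<bar> \<le> Cf"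
  proof -
    have "compact ((\<lambda>y. f y - f p) ` X)" by (intro compact_continuous_image X continuous_intros f)
    from compact_imp_bounded[OF this] obtain r where "\<forall>v\<in>(\<lambda>y. f y - f p) ` X. \<bar>v\<bar> \<le> r"
      unfolding bounded_iff real_norm_def by blast
    then show ?thesis by (intro that[of r]) simp
  qed
  have \<Phi>0: "0 \<le> \<Phi> k \<omega>" for k \<omega> unfolding \<Phi>_def by simp
  have \<Phi>b: "\<Phi> k \<omega> \<le> exp (Cb + (\<Sum>j=1..<k. \<alpha> j * Cf))" if "k \<ge> 1" "\<omega> \<in> space M" for k \<omega>
  proof -
    have "(\<Sum>j=1..<k. \<alpha> j * (f (x j \<omega>) - f p)) \<le> (\<Sum>j=1..<k. \<alpha> j * Cf)"
    proof (intro sum_mono mult_left_mono)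
      fix j assume "j \<in> {1..<k}"
      then show "f (x j \<omega>) - f p \<le> Cf" "0 \<le> \<alpha> j"
        using Cf[OF xX[of j \<omega>]] step_pos that by (auto simp: less_imp_le)
    qed
    then show ?thesis unfolding \<Phi>_def using Cb[OF xX[OF that]] by simp
  qed
  have \<Phi>int: "integrable M (\<Phi> k)" if "k \<ge> 1" for k
    by (rule integrable_const_bound[of _ "exp (Cb + (\<Sum>j=1..<k. \<alpha> j * Cf))"])
      (use \<Phi>b[OF that] \<Phi>0 \<Phi>M[OF that] in \<open>auto intro!: AE_I2\<close>)

  define \<beta> where "\<beta> k = L * d * (\<alpha> k * B k) + C2 * (\<alpha> k)\<^sup>2" for k
  have step: "(\<integral>\<omega>. \<Phi> (Suc k) \<omega> \<partial>M) \<le> exp (\<beta> k) * (\<integral>\<omega>. \<Phi> k \<omega> \<partial>M)" if k: "k \<ge> 1" for k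
  proof -
    interpret Fk: finite_measure_subalgebra M "history M x k" by (rule sub)
    have \<alpha>: "0 < \<alpha> k" using step_pos k by simp
    have bM[measurable]: "b k \<in> borel_measurable M"
      by (rule measurable_from_subalg[OF Fk.subalg]) (use bias_measurable k in blast)
    have gM[measurable]: "g k \<in> borel_measurable M" "gt k \<in> borel_measurable M" using rv k by auto
    have \<zeta>M[measurable]: "\<zeta> k \<in> borel_measurable M" unfolding noise by measurable
    have AEg: "AE \<omega> in M. norm (g k \<omega>) \<le> H"
      using subgradient[rule_format, OF k]
    proof (rule AE_mp, intro AE_I2 impI)
      fix \<omega> assume "\<omega> \<in> space M" "g k \<omega> \<in> subdifferential f (x k \<omega>)"
      then have "dual_norm N (g k \<omega>) \<le> G" using G(2) xX[OF k] by blast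
      then show "norm (g k \<omega>) \<le> H"
        unfolding H_def using dual[of "g k \<omega>"] L(1) by (meson less_imp_le mult_left_mono order_trans)
    qed
    have AEb: "AE \<omega> in M. norm (b k \<omega>) \<le> L * B k"
      using bias(2)[rule_format, OF k]
      by eventually_elim (use dual L(1) in \<open>meson less_imp_le mult_left_mono order_trans\<close>)
    have cond: "AE \<omega> in M. nn_cond_exp M (history M x k) (\<lambda>\<omega>. ennreal (exp (r * \<zeta> k \<omega> $ i))) \<omega>
        \<le> ennreal (exp (1 / 2 * L\<^sup>2 * \<nu>\<^sup>2 * r\<^sup>2))" for r :: real and i
    proof -
      have "(N (axis i 1))\<^sup>2 \<le> L\<^sup>2"
        using L(2)[of "axis i 1"] norm_N unfolding is_norm_def by (intro power_mono) auto
      then have "1 / 2 * (N (axis i 1))\<^sup>2 * \<nu>\<^sup>2 * r\<^sup>2 \<le> 1 / 2 * L\<^sup>2 * \<nu>\<^sup>2 * r\<^sup>2"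
        by (intro mult_right_mono mult_left_mono) auto
      then have le: "ennreal (exp (1 / 2 * (N (axis i 1))\<^sup>2 * \<nu>\<^sup>2 * r\<^sup>2)) \<le> ennreal (exp (1 / 2 * L\<^sup>2 * \<nu>\<^sup>2 * r\<^sup>2))"
        by (intro ennreal_leI) simp
      have ax: "axis i 1 \<bullet> \<zeta> k \<omega> = \<zeta> k \<omega> $ i" for \<omega> by (simp add: inner_axis')
      show ?thesis
        using subgaussian[rule_format, OF k, of r "axis i 1"] unfolding ax
        by eventually_elim (use le order_trans in blast)
    qed
    have \<zeta>int: "integrable M (\<lambda>\<omega>. \<zeta> k \<omega> $ i)" for i
      by (rule integrable_of_cond_exp_moments[OF sub \<zeta>M cond]) simp
    have gtint: "integrable M (\<lambda>\<omega>. gt k \<omega> $ i)" for i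
    proof -
      have "integrable M (\<lambda>\<omega>. (g k \<omega> + b k \<omega>) $ i)"
      proof (rule integrable_const_bound[of _ "H + L * B k"])
        show "AE \<omega> in M. norm ((g k \<omega> + b k \<omega>) $ i) \<le> H + L * B k"
          using AEg AEb
        proof eventually_elim
          case (elim \<omega>)
          then show ?case
            using component_le_norm_cart[of "g k \<omega> + b k \<omega>" i] norm_triangle_ineq[of "g k \<omega>" "b k \<omega>"] by simp
        qed
        show "(\<lambda>\<omega>. (g k \<omega> + b k \<omega>) $ i) \<in> borel_measurable M"
          by (rule measurable_compose[OF _ borel_measurable_nth]) measurable
      qed
      from Bochner_Integration.integrable_add[OF this \<zeta>int[of i]] show ?thesis
        unfolding noise by simp
    qed
    have \<zeta>E: "AE \<omega> in M. \<zeta> k \<omega> = gt k \<omega> - vec_cond_exp M (history M x k) (gt k) \<omega>"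
      using mean[rule_format, OF k] by eventually_elim (simp add: noise)
    have V: "(\<lambda>\<omega>. p - x k \<omega>) \<in> borel_measurable (history M x k)"
      by (intro borel_measurable_diff borel_measurable_const measurable_history k order_refl)
    have V1: "norm (p - x k \<omega>) \<le> d" if "\<omega> \<in> space M" for \<omega> using d(2) p xX[OF k that] by blast
    have e0: "0 \<le> e" unfolding e_def by simp
    have CC: "0 \<le> C1 * (\<alpha> k)\<^sup>2" using C1 by simp
    have cond1: "AE \<omega> in M. nn_cond_exp M (history M x k) (\<lambda>\<omega>. ennreal (exp (s * CARD('n) * \<zeta> k \<omega> $ i))) \<omega>
        \<le> ennreal e" for i
      using cond[of "s * CARD('n)" i] unfolding e_def by simp
    have cond2: "AE \<omega> in M. nn_cond_exp M (history M x k) (\<lambda>\<omega>. ennreal (exp (- (s * CARD('n)) * \<zeta> k \<omega> $ i))) \<omega>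
        \<le> ennreal e" for i
      using cond[of "- (s * CARD('n))" i] unfolding e_def power2_minus .
    note lin = Fk.integral_mult_linear_exp_le[OF \<Phi>F[OF k] \<Phi>0 \<Phi>b[OF k] V V1 gtint \<zeta>M \<zeta>E cond1 cond2 s0 e0 CC,
      where \<alpha> = "\<alpha> k"]
    have ptw: "AE \<omega> in M. \<Phi> (Suc k) \<omega> \<le> exp (L * d * (\<alpha> k * B k)) *
        (\<Phi> k \<omega> * (1 + \<alpha> k * (\<zeta> k \<omega> \<bullet> (p - x k \<omega>)) + C1 * (\<alpha> k)\<^sup>2 * exp (s * norm (\<zeta> k \<omega>))))"
      using AEg AEb subgradient[rule_format, OF k] AE_space
    proof eventually_elim
      case (elim \<omega>)
      define y z where "y = x k \<omega>" and "z = x (Suc k) \<omega>"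
      have yz: "y \<in> X" "z \<in> X" unfolding y_def z_def using xX elim(4) k by auto
      have "is_arg_min (\<lambda>u. gt k \<omega> \<bullet> (u - y) + 1 / \<alpha> k * bregman R u y) (\<lambda>u. u \<in> X) z"
        using iterates k elim(4) unfolding y_def z_def by simp
      from mirror_step_inequality[OF this X(1) \<alpha> p diff[OF yz(2)]]
      have 1: "bregman R p z \<le> bregman R p y - \<alpha> k * (gt k \<omega> \<bullet> (z - p)) - c * (norm (y - z))\<^sup>2"
        using breg[OF yz(2,1)] by (simp add: norm_minus_commute)
      \<comment> \<open>The bias is paired with \<open>p - z\<close> and not \<open>p - y\<close>: this keeps it out of the quadratic excess,
        as the numbers \<open>B k\<close> may be unbounded and only \<open>\<alpha> k * B k\<close> is summable.\<close>
      have "- (gt k \<omega> \<bullet> (z - p)) = g k \<omega> \<bullet> (p - y) + b k \<omega> \<bullet> (p - z)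
          + \<zeta> k \<omega> \<bullet> (p - y) + (g k \<omega> + \<zeta> k \<omega>) \<bullet> (y - z)"
        unfolding noise by (simp add: inner_simps)
      moreover have "g k \<omega> \<bullet> (p - y) \<le> f p - f y"
        using elim(3) unfolding subdifferential_def y_def by (simp add: algebra_simps)
      moreover have "b k \<omega> \<bullet> (p - z) \<le> L * B k * d"
      proof -
        have "b k \<omega> \<bullet> (p - z) \<le> norm (b k \<omega>) * norm (p - z)" by (rule norm_cauchy_schwarz)
        also have "\<dots> \<le> L * B k * d"
          using elim(2) d(2)[OF p yz(2)] L(1) bias(1) k by (intro mult_mono) auto
        finally show ?thesis .
      qed
      ultimately have "- (gt k \<omega> \<bullet> (z - p)) \<le> (f p - f y) + L * B k * d
          + (\<zeta> k \<omega> \<bullet> (p - y) + (g k \<omega> + \<zeta> k \<omega>) \<bullet> (y - z))" by linarith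
      then have "\<alpha> k * (- (gt k \<omega> \<bullet> (z - p))) \<le> \<alpha> k * ((f p - f y) + L * B k * d
          + (\<zeta> k \<omega> \<bullet> (p - y) + (g k \<omega> + \<zeta> k \<omega>) \<bullet> (y - z)))" using \<alpha> by (intro mult_left_mono) auto
      then have "bregman R p z + \<alpha> k * (f y - f p) \<le> bregman R p y + L * d * (\<alpha> k * B k)
          + (\<alpha> k * (\<zeta> k \<omega> \<bullet> (p - y)) + (\<alpha> k * ((g k \<omega> + \<zeta> k \<omega>) \<bullet> (y - z)) - c * (norm (y - z))\<^sup>2))"
        using 1 by (simp add: algebra_simps)
      moreover have "\<Phi> (Suc k) \<omega> = exp ((\<Sum>j=1..<k. \<alpha> j * (f (x j \<omega>) - f p)) + (bregman R p z + \<alpha> k * (f y - f p)))"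
        unfolding \<Phi>_def y_def z_def using k by (simp add: add_ac)
      ultimately have "\<Phi> (Suc k) \<omega> \<le> exp ((\<Sum>j=1..<k. \<alpha> j * (f (x j \<omega>) - f p))
          + (bregman R p y + L * d * (\<alpha> k * B k)
          + (\<alpha> k * (\<zeta> k \<omega> \<bullet> (p - y)) + (\<alpha> k * ((g k \<omega> + \<zeta> k \<omega>) \<bullet> (y - z)) - c * (norm (y - z))\<^sup>2))))"
        by simp
      also have "\<dots> = exp (L * d * (\<alpha> k * B k)) * (\<Phi> k \<omega>
          * exp (\<alpha> k * (\<zeta> k \<omega> \<bullet> (p - y)) + (\<alpha> k * ((g k \<omega> + \<zeta> k \<omega>) \<bullet> (y - z)) - c * (norm (y - z))\<^sup>2)))"
        unfolding \<Phi>_def y_def exp_add[symmetric] by (simp only: add_ac)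
      also have "\<dots> \<le> exp (L * d * (\<alpha> k * B k)) * (\<Phi> k \<omega>
          * (1 + \<alpha> k * (\<zeta> k \<omega> \<bullet> (p - y)) + C1 * (\<alpha> k)\<^sup>2 * exp (s * norm (\<zeta> k \<omega>))))"
      proof (intro mult_left_mono \<Phi>0)
        show "exp (\<alpha> k * (\<zeta> k \<omega> \<bullet> (p - y)) + (\<alpha> k * ((g k \<omega> + \<zeta> k \<omega>) \<bullet> (y - z)) - c * (norm (y - z))\<^sup>2))
          \<le> 1 + \<alpha> k * (\<zeta> k \<omega> \<bullet> (p - y)) + C1 * (\<alpha> k)\<^sup>2 * exp (s * norm (\<zeta> k \<omega>))"
          unfolding C1_def s_def
          by (rule exp_step_bound[OF c d(1) a0])
            (use \<alpha> a[OF k] elim(1) d(2) p yz L(1) G(1) in \<open>auto simp: H_def\<close>)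
      qed simp
      finally show ?case unfolding y_def .
    qed
    have "(\<integral>\<omega>. \<Phi> (Suc k) \<omega> \<partial>M) \<le> (\<integral>\<omega>. exp (L * d * (\<alpha> k * B k)) *
        (\<Phi> k \<omega> * (1 + \<alpha> k * (\<zeta> k \<omega> \<bullet> (p - x k \<omega>)) + C1 * (\<alpha> k)\<^sup>2 * exp (s * norm (\<zeta> k \<omega>)))) \<partial>M)"
      by (rule integral_mono_AE[OF \<Phi>int integrable_mult_right[OF lin(1)] ptw]) simp
    also have "\<dots> \<le> exp (L * d * (\<alpha> k * B k)) * ((1 + C1 * (\<alpha> k)\<^sup>2 * (2 * CARD('n) * e)) * (\<integral>\<omega>. \<Phi> k \<omega> \<partial>M))"
      using lin(2) by simp
    also have "\<dots> \<le> exp (L * d * (\<alpha> k * B k)) * (exp (C2 * (\<alpha> k)\<^sup>2) * (\<integral>\<omega>. \<Phi> k \<omega> \<partial>M))"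
    proof (intro mult_left_mono mult_right_mono)
      show "1 + C1 * (\<alpha> k)\<^sup>2 * (2 * CARD('n) * e) \<le> exp (C2 * (\<alpha> k)\<^sup>2)"
        using exp_ge_add_one_self[of "C2 * (\<alpha> k)\<^sup>2"] unfolding C2_def by (simp add: mult_ac)
    qed (use \<Phi>0 in auto)
    also have "\<dots> = exp (\<beta> k) * (\<integral>\<omega>. \<Phi> k \<omega> \<partial>M)" unfolding \<beta>_def by (simp add: exp_add)
    finally show ?thesis .
  qed
  have \<beta>sum: "summable (\<lambda>k. \<beta> (Suc k))"
    unfolding \<beta>_def by (intro summable_add summable_mult bias sq_summable)
  have \<beta>0: "\<beta> k \<ge> 0" if "k \<ge> 1" for k
    unfolding \<beta>_def using that step_pos bias(1) L(1) d(1) C2 by (simp add: less_imp_le)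
  have int0: "0 \<le> (\<integral>\<omega>. \<Phi> 1 \<omega> \<partial>M)" using \<Phi>0 by simp
  have bound: "(\<integral>\<omega>. \<Phi> (Suc t) \<omega> \<partial>M) \<le> exp (\<Sum>k. \<beta> (Suc k)) * (\<integral>\<omega>. \<Phi> 1 \<omega> \<partial>M)" for t
    using step \<beta>sum \<beta>0 int0 by (rule exp_recursion_le)
  define S where "S t \<omega> = exp (\<Sum>k=1..t. \<alpha> k * (f (x k \<omega>) - f p))" for t \<omega>
  have S\<Phi>: "S t \<omega> \<le> \<Phi> (Suc t) \<omega>" if "\<omega> \<in> space M" for t \<omega>
    using breg0[OF xX[OF _ that, of "Suc t"]] unfolding S_def \<Phi>_def atLeastLessThanSuc_atLeastAtMost by simp
  have SM: "S t \<in> borel_measurable M" for t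
  proof -
    have "(\<lambda>\<omega>. f (x j \<omega>)) \<in> borel_measurable M" if "j \<in> {1..t}" for j
      by (rule measurable_continuous_compose_in[OF _ xX compact_imp_closed[OF X(2)] f]) (use that rv in auto)
    then show ?thesis unfolding S_def
      by (intro borel_measurable_exp[THEN measurable_compose[rotated]] borel_measurable_sum
          borel_measurable_times borel_measurable_diff borel_measurable_const)
  qed
  have Sint: "integrable M (S t)" for t
  proof (rule Bochner_Integration.integrable_bound[OF \<Phi>int SM])
    show "AE \<omega> in M. norm (S t \<omega>) \<le> norm (\<Phi> (Suc t) \<omega>)"
      using S\<Phi> \<Phi>0 by (intro AE_I2) (simp add: S_def)
  qed simp
  have "(\<integral>\<omega>. S t \<omega> \<partial>M) \<le> exp (\<Sum>k. \<beta> (Suc k)) * (\<integral>\<omega>. \<Phi> 1 \<omega> \<partial>M)" for t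
    using integral_mono[OF Sint[of t] \<Phi>int[of "Suc t"] S\<Phi>] bound[of t] by simp
  then show ?thesis using that[OF Sint[unfolded S_def]] unfolding S_def by blast
qed

section \<open>The tail bound for the averaged iterate\<close>

lemma weighted_avg_jensen:
  assumes f: "convex_on UNIV f" and \<alpha>: "\<And>k. k \<ge> 1 \<Longrightarrow> \<alpha> k > 0" and t: "t \<ge> 1"
  shows "(\<Sum>k=1..t. \<alpha> k) * (f (weighted_avg \<alpha> x t) - c) \<le> (\<Sum>k=1..t. \<alpha> k * (f (x k) - c))"
proof -
  define A where "A = (\<Sum>k=1..t. \<alpha> k)"
  have A: "A > 0" unfolding A_def using t \<alpha> by (intro sum_pos) auto
  have "f (\<Sum>k=1..t. (\<alpha> k / A) *\<^sub>R x k) \<le> (\<Sum>k=1..t. \<alpha> k / A * f (x k))"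
  proof (rule convex_on_sum[OF _ _ f])
    show "(\<Sum>k=1..t. \<alpha> k / A) = 1" using A unfolding sum_divide_distrib[symmetric] A_def by simp
    show "\<alpha> k / A \<ge> 0" if "k \<in> {1..t}" for k using that \<alpha>[of k] A by simp
  qed (use t in auto)
  moreover have "(\<Sum>k=1..t. (\<alpha> k / A) *\<^sub>R x k) = weighted_avg \<alpha> x t"
    unfolding weighted_avg_def A_def[symmetric] scaleR_sum_right by (simp add: divide_inverse mult.commute)
  ultimately have "A * f (weighted_avg \<alpha> x t) \<le> A * (\<Sum>k=1..t. \<alpha> k / A * f (x k))"
    using A by (intro mult_left_mono) auto
  also have "\<dots> = (\<Sum>k=1..t. \<alpha> k * f (x k))"
    unfolding sum_distrib_left using A by (intro sum.cong) auto
  finally show ?thesis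
    unfolding A_def by (simp add: right_diff_distrib sum_subtractf sum_distrib_right)
qed

theorem theorem5:
  fixes N :: "real ^ 'n \<Rightarrow> real"
    and X U :: "(real ^ 'n) set"
    and f R :: "real ^ 'n \<Rightarrow> real"
    and M :: "'w measure"
    and x gt g b \<zeta> :: "nat \<Rightarrow> 'w \<Rightarrow> real ^ 'n"
    and \<alpha> B :: "nat \<Rightarrow> real"
    and D fstar G \<sigma>\<^sub>R \<nu> \<nu>\<^sub>1 \<nu>\<^sub>2 \<kappa>\<^sub>1 K \<epsilon> :: real
  assumes norm_N: "is_norm N"
    and X: "X \<noteq> {}" "convex X" "compact X"
    and D: "D = diam N X"
    and f: "convex_on UNIV f" "continuous_on UNIV f"
    and fstar: "fstar = (LEAST v. v \<in> f ` X)"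
    and G: "G > 0" "\<forall>y\<in>X. \<forall>h\<in>subdifferential f y. dual_norm N h \<le> G"
    and R: "\<sigma>\<^sub>R > 0" "open U" "X \<subseteq> U" "strongly_convex_on U N \<sigma>\<^sub>R R" "R differentiable_on U"
    and M: "prob_space M"
    and step_pos: "\<forall>t\<ge>1. \<alpha> t > 0"
    and random_vectors: "\<forall>t\<ge>1. x t \<in> borel_measurable M"
      "\<forall>t\<ge>1. gt t \<in> borel_measurable M"
      "\<forall>t\<ge>1. g t \<in> borel_measurable M"
    and initial: "\<forall>\<omega>\<in>space M. x 1 \<omega> \<in> X"
    and iterates: "\<forall>t\<ge>1. \<forall>\<omega>\<in>space M.
      is_arg_min (\<lambda>u. gt t \<omega> \<bullet> (u - x t \<omega>) + 1 / \<alpha> t * bregman R u (x t \<omega>)) (\<lambda>u. u \<in> X) (x (t + 1) \<omega>)"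
    and A1_bias_measurable: "\<forall>t\<ge>1. b t \<in> borel_measurable (history M x t)"
    and A1_subgradient: "\<forall>t\<ge>1. AE \<omega> in M. g t \<omega> \<in> subdifferential f (x t \<omega>)"
    and A1_mean: "\<forall>t\<ge>1. AE \<omega> in M. vec_cond_exp M (history M x t) (gt t) \<omega> = g t \<omega> + b t \<omega>"
    and A1_second_moment: "\<forall>t\<ge>1. AE \<omega> in M.
      nn_cond_exp M (history M x t) (\<lambda>\<omega>'. ennreal ((dual_norm N (gt t \<omega>'))\<^sup>2)) \<omega> \<le> ennreal (\<nu>\<^sup>2)"
    and noise: "\<zeta> = (\<lambda>t \<omega>. gt t \<omega> - g t \<omega> - b t \<omega>)"
    and A2: "filterlim (\<lambda>t. \<Sum>k=1..t. \<alpha> k) at_top sequentially"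
      "summable (\<lambda>k. (\<alpha> (Suc k))\<^sup>2)"
    and A3: "\<forall>t\<ge>1. B t \<ge> 0"
      "\<forall>t\<ge>1. AE \<omega> in M. dual_norm N (b t \<omega>) \<le> B t"
      "summable (\<lambda>k. \<alpha> (Suc k) * B (Suc k))"
    and A4: "\<nu>\<^sub>1 > 0"
      "\<forall>t\<ge>1. \<forall>v. \<forall>s::real. AE \<omega> in M.
        nn_cond_exp M (history M x t) (\<lambda>\<omega>'. ennreal (exp (s * (v \<bullet> \<zeta> t \<omega>')))) \<omega>
          \<le> ennreal (exp (1 / 2 * (N v)\<^sup>2 * \<nu>\<^sub>1\<^sup>2 * s\<^sup>2))"
    and \<kappa>\<^sub>1: "\<kappa>\<^sub>1 > 0"
      "\<forall>u v w. (dual_norm N (u + v + w))\<^sup>2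
        \<le> \<kappa>\<^sub>1 * ((dual_norm N u)\<^sup>2 + (dual_norm N v)\<^sup>2 + (dual_norm N w)\<^sup>2)"
    and \<nu>\<^sub>2: "\<nu>\<^sub>2 > 0"
      "\<forall>t\<ge>1. AE \<omega> in M.
        nn_cond_exp M (history M x t) (\<lambda>\<omega>'. ennreal ((dual_norm N (\<zeta> t \<omega>')) ^ 4)) \<omega> \<le> ennreal (\<nu>\<^sub>2\<^sup>2)"
    and K: "K = exp (- (\<Sum>k. 2 * \<alpha> (Suc k) * B (Suc k) / \<sigma>\<^sub>R))"
    and \<epsilon>: "\<epsilon> > 0"
  shows "\<exists>t\<^sub>0. \<forall>t\<ge>t\<^sub>0.
    measure M {\<omega> \<in> space M. f (weighted_avg \<alpha> (\<lambda>j. x j \<omega>) t) - fstar \<ge> \<epsilon>}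
      \<le> exp (- (\<epsilon>\<^sup>2 * K\<^sup>2 * (\<Sum>k=1..t. \<alpha> k)\<^sup>2)
               / (18 * D\<^sup>2 * \<nu>\<^sub>1\<^sup>2 * (\<Sum>k=1..t. (\<alpha> k)\<^sup>2)))
        + exp (\<Sum>k=1..t. (\<alpha> k)\<^sup>2 / (2 * \<sigma>\<^sub>R) * \<kappa>\<^sub>1
                 * (G\<^sup>2 + (B k)\<^sup>2 + \<nu>\<^sub>2\<^sup>2 * (\<alpha> k)\<^sup>2 * \<kappa>\<^sub>1 / (4 * \<sigma>\<^sub>R)))
          / exp (\<epsilon> / 3 * K * (\<Sum>k=1..t. \<alpha> k))"
proof -
  interpret prob_space M by fact
  obtain p where p: "p \<in> X" "\<And>y. y \<in> X \<Longrightarrow> f p \<le> f y"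
    using continuous_attains_inf[OF X(3,1) continuous_on_subset[OF f(2)]] by blast
  have fp: "fstar = f p" unfolding fstar by (rule Least_equality) (use p in auto)
  obtain C where Cint: "\<And>t. integrable M (\<lambda>\<omega>. exp (\<Sum>k=1..t. \<alpha> k * (f (x k \<omega>) - f p)))"
    and C: "\<And>t. (\<integral>\<omega>. exp (\<Sum>k=1..t. \<alpha> k * (f (x k \<omega>) - f p)) \<partial>M) \<le> C"
    by (rule mirror_descent_exponential_moment[OF norm_N X(2,3) p(1) continuous_on_subset[OF f(2) subset_UNIV]
      G R M step_pos random_vectors initial iterates A1_bias_measurable A1_subgradient A1_mean noise A2(2) A3 A4(2)])
      blast
  define A where "A t = (\<Sum>k=1..t. \<alpha> k)" for t
  have A0: "A t \<ge> 0" for t unfolding A_def using step_pos by (intro sum_nonneg) (simp add: less_imp_le)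
  have K: "0 < K" "K \<le> 1"
  proof -
    have eq: "2 * \<alpha> (Suc k) * B (Suc k) / \<sigma>\<^sub>R = 2 / \<sigma>\<^sub>R * (\<alpha> (Suc k) * B (Suc k))" for k by simp
    have "0 \<le> (\<Sum>k. 2 * \<alpha> (Suc k) * B (Suc k) / \<sigma>\<^sub>R)"
    proof (rule suminf_nonneg)
      show "summable (\<lambda>k. 2 * \<alpha> (Suc k) * B (Suc k) / \<sigma>\<^sub>R)" unfolding eq by (intro summable_mult A3)
      show "0 \<le> 2 * \<alpha> (Suc k) * B (Suc k) / \<sigma>\<^sub>R" for k
        using step_pos A3(1) R(1) by (simp add: less_imp_le)
    qed
    then show "0 < K" "K \<le> 1" unfolding K by auto
  qed
  have "eventually (\<lambda>t. 3 / (2 * \<epsilon>) * C \<le> A t) sequentially"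
    using A2(1) unfolding A_def filterlim_at_top by blast
  then obtain t0 where t0: "\<And>t. t \<ge> t0 \<Longrightarrow> 3 / (2 * \<epsilon>) * C \<le> A t"
    unfolding eventually_sequentially by blast
  show ?thesis
  proof (intro exI[of _ "max 1 t0"] allI impI)
    fix t assume t: "max 1 t0 \<le> t"
    define S where "S \<omega> = (\<Sum>k=1..t. \<alpha> k * (f (x k \<omega>) - f p))" for \<omega>
    have Sint: "integrable M (\<lambda>\<omega>. exp (S \<omega>))" unfolding S_def by (rule Cint)
    have "exp (A t * \<epsilon>) \<le> exp (S \<omega>)" if "f (weighted_avg \<alpha> (\<lambda>j. x j \<omega>) t) - fstar \<ge> \<epsilon>" for \<omega>
    proof -
      have "A t * \<epsilon> \<le> A t * (f (weighted_avg \<alpha> (\<lambda>j. x j \<omega>) t) - f p)"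
        using A0 that unfolding fp by (intro mult_left_mono)
      also have "\<dots> \<le> S \<omega>"
        unfolding A_def S_def by (rule weighted_avg_jensen[OF f(1)]) (use step_pos t in auto)
      finally show ?thesis by simp
    qed
    then have "{\<omega> \<in> space M. f (weighted_avg \<alpha> (\<lambda>j. x j \<omega>) t) - fstar \<ge> \<epsilon>}
        \<subseteq> {\<omega> \<in> space M. exp (S \<omega>) \<ge> exp (A t * \<epsilon>)}" by blast
    moreover have "{\<omega> \<in> space M. exp (S \<omega>) \<ge> exp (A t * \<epsilon>)} \<in> sets M"
      using borel_measurable_integrable[OF Sint] by measurable
    ultimately have "prob {\<omega> \<in> space M. f (weighted_avg \<alpha> (\<lambda>j. x j \<omega>) t) - fstar \<ge> \<epsilon>}
        \<le> prob {\<omega> \<in> space M. exp (S \<omega>) \<ge> exp (A t * \<epsilon>)}" by (rule finite_measure_mono)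
    also have "\<dots> \<le> (\<integral>\<omega>. exp (S \<omega>) \<partial>M) / exp (A t * \<epsilon>)"
      by (rule integral_Markov_inequality_measure[OF Sint, of "{}"]) auto
    also have "\<dots> \<le> C / exp (A t * \<epsilon>)"
      using C[of t] unfolding S_def by (intro divide_right_mono) auto
    also have "\<dots> \<le> 1 / exp (\<epsilon> / 3 * K * A t)"
    proof -
      have "3 / (2 * \<epsilon>) * C \<le> A t" using t t0 by simp
      then have "C \<le> 2 * \<epsilon> / 3 * A t" using \<epsilon> by (simp add: field_simps)
      also have "\<dots> \<le> exp (2 * \<epsilon> / 3 * A t)" using exp_ge_add_one_self[of "2 * \<epsilon> / 3 * A t"] by linarith
      also have "\<dots> \<le> exp (A t * \<epsilon> - \<epsilon> / 3 * K * A t)"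
      proof -
        have "K * (\<epsilon> / 3 * A t) \<le> 1 * (\<epsilon> / 3 * A t)" using K(2) A0[of t] \<epsilon> by (intro mult_right_mono) auto
        then show ?thesis by (simp add: algebra_simps)
      qed
      finally have "C \<le> exp (A t * \<epsilon>) / exp (\<epsilon> / 3 * K * A t)" by (simp only: exp_diff)
      then have "C / exp (A t * \<epsilon>) \<le> exp (A t * \<epsilon>) / exp (\<epsilon> / 3 * K * A t) / exp (A t * \<epsilon>)"
        by (intro divide_right_mono) auto
      then show ?thesis by simp
    qed
    also have "\<dots> \<le> exp (\<Sum>k=1..t. (\<alpha> k)\<^sup>2 / (2 * \<sigma>\<^sub>R) * \<kappa>\<^sub>1
                 * (G\<^sup>2 + (B k)\<^sup>2 + \<nu>\<^sub>2\<^sup>2 * (\<alpha> k)\<^sup>2 * \<kappa>\<^sub>1 / (4 * \<sigma>\<^sub>R)))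
          / exp (\<epsilon> / 3 * K * (\<Sum>k=1..t. \<alpha> k))"
      unfolding A_def using R(1) \<kappa>\<^sub>1(1)
      by (intro divide_right_mono) (auto intro!: sum_nonneg)
    finally show "prob {\<omega> \<in> space M. f (weighted_avg \<alpha> (\<lambda>j. x j \<omega>) t) - fstar \<ge> \<epsilon>}
      \<le> exp (- (\<epsilon>\<^sup>2 * K\<^sup>2 * (\<Sum>k=1..t. \<alpha> k)\<^sup>2)
               / (18 * D\<^sup>2 * \<nu>\<^sub>1\<^sup>2 * (\<Sum>k=1..t. (\<alpha> k)\<^sup>2)))
        + exp (\<Sum>k=1..t. (\<alpha> k)\<^sup>2 / (2 * \<sigma>\<^sub>R) * \<kappa>\<^sub>1
                 * (G\<^sup>2 + (B k)\<^sup>2 + \<nu>\<^sub>2\<^sup>2 * (\<alpha> k)\<^sup>2 * \<kappa>\<^sub>1 / (4 * \<sigma>\<^sub>R)))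
          / exp (\<epsilon> / 3 * K * (\<Sum>k=1..t. \<alpha> k))"
      by (simp add: add_increasing)
  qed
qed

end
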